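(* For each positive integer $m$, there exists a compact Hausdorff space $X$ with $\dim X=m$ such that $C(X)$ is $n$-th root closed for every positive integer $n$.
   Context: $\dim$ denotes covering dimension. $C(X)$ denotes the algebra of all bounded continuous complex-valued functions on $X$. $C(X)$ is called $n$-th root closed if for every $f\in C(X)$ there exists $g\in C(X)$ such that $f=g^n$. *)

theory Defs
  imports "HOL-Analysis.Analysis"
begin

text \<open>
  Covering (Lebesgue) dimension, defined by finite open covers. The number of members of the
  refinement through a point is at most \<open>n + 1\<close>. The predicate \<open>dim_le\<close> of the library is the
  small inductive dimension, which differs from the covering dimension for general compact
  Hausdorff spaces.
\<close>

definition finite_open_cover :: "'a topology \<Rightarrow> 'a set set \<Rightarrow> bool" where
  "finite_open_cover X \<U> \<longleftrightarrow> finite \<U> \<and> (\<forall>U\<in>\<U>. openin X U) \<and> \<Union>\<U> = topspace X"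

definition covering_dim_le :: "'a topology \<Rightarrow> int \<Rightarrow> bool" where
  "covering_dim_le X n \<longleftrightarrow>
     (\<forall>\<U>. finite_open_cover X \<U> \<longrightarrow>
       (\<exists>\<V>. finite_open_cover X \<V> \<and>
            (\<forall>V\<in>\<V>. \<exists>U\<in>\<U>. V \<subseteq> U) \<and>
            (\<forall>x\<in>topspace X. int (card {V\<in>\<V>. x \<in> V}) \<le> n + 1)))"

text \<open>
  The value is \<open>-1\<close> for the empty space and \<open>\<infinity>\<close> if no bound holds. The restriction to
  \<open>n \<ge> -1\<close> matters for the empty space only, where the bound holds vacuously for all \<open>n\<close>.
\<close>

definition covering_dim :: "'a topology \<Rightarrow> ereal" where
  "covering_dim X = Inf {ereal (real_of_int n) | n. -1 \<le> n \<and> covering_dim_le X n}"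

text \<open>
  The elements of \<open>C(X)\<close> are represented by total functions, of which only the values on
  \<open>topspace X\<close> matter; accordingly, equality in \<open>C(X)\<close> is equality on \<open>topspace X\<close>.
\<close>

definition bounded_cfuns :: "'a topology \<Rightarrow> ('a \<Rightarrow> complex) set" where
  "bounded_cfuns X = {f. continuous_map X euclidean f \<and> bounded (f ` topspace X)}"

definition root_closed :: "nat \<Rightarrow> 'a topology \<Rightarrow> bool" where
  "root_closed n X \<longleftrightarrow>
     (\<forall>f\<in>bounded_cfuns X. \<exists>g\<in>bounded_cfuns X. \<forall>x\<in>topspace X. f x = g x ^ n)"

text \<open>
  HOL has no quantification over types, so the existence of a space has to be stated for a
  topology on some subset of a fixed type. The following type has \<open>2^(2^c)\<close> elements, where \<open>c\<close>
  is the cardinality of the continuum, so every compact Hausdorff space of weight at most \<open>2^c\<close>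
  has a homeomorphic copy among the topologies on its subsets; such a topology is arbitrary and
  need not be induced by the product topology.
\<close>

type_synonym large_carrier = "(real \<Rightarrow> real) \<Rightarrow> real"

end

theory Submission
  imports Defs "HOL-Library.Multiset" "Jordan_Normal_Form.Determinant"
begin

text \<open>
  Start with the \<open>m\<close>-dimensional torus and adjoin an \<open>n\<close>-th root of every function that depends on
  countably many of the coordinates constructed before. The coordinates form a datatype: \<open>Base j\<close> is a
  coordinate of the torus, and \<open>Root n \<iota> \<phi>\<close> is an \<open>(n + 1)\<close>-st root of the function \<open>\<phi> (x \<circ> \<iota>)\<close> of
  the coordinates \<open>\<iota> 0, \<iota> 1, \<dots>\<close>. Every continuous function on the compact space \<open>tower m\<close> of all
  solutions depends on countably many coordinates, hence has all roots.

  Adjoining a root does not raise the dimension, because a fine open cover lifts to the branches of the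
  root without increasing its order. It does not lower it either, because averaging over the branches
  is a transfer for real Alexander-Spanier cochains, so that the fundamental cocycle of the torus, the
  determinant of small angle differences, does not become a coboundary. Both arguments concern
  finitely many coordinates only and proceed by well-founded induction on them.
\<close>

section \<open>Compact sets of functions\<close>

text \<open>Closing under roots of all continuous functions is a transfinite process whose length is
  the first uncountable ordinal; the countable branching of \<open>idx\<close> carries it out at
  once, an index being a well-founded tree. As there are uncountably many coordinates, sizes are
  measured by \<open>close A e\<close> with finite \<open>A\<close>, the basic entourages of the
  product uniformity, and the dimension arguments work at a fixed scale \<open>(A, e)\<close>.
  Eliminating a root from \<open>A\<close> costs finitely many of its arguments, found by uniform
  continuity.

  The obstacle is the zero set of the right-hand side, where the root map branches and is no
  covering. It is blurred by a threshold: below it all roots are within the tolerance of each other,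
  above it ratios of nearby values lie near 1 and the principal root continues a branch
  unambiguously.

  Real coefficients allow division by the number of branches. The cup product of the angle cocycles
  is antisymmetrized because the determinant vanishes as soon as any two vertices, consecutive or
  not, carry the same label.\<close>

definition close :: "'i set \<Rightarrow> real \<Rightarrow> ('i \<Rightarrow> 'a::metric_space) \<Rightarrow> ('i \<Rightarrow> 'a) \<Rightarrow> bool" where
  "close A e x y \<longleftrightarrow> (\<forall>i\<in>A. dist (x i) (y i) < e)"

lemma close_mono: "close A e x y \<Longrightarrow> B \<subseteq> A \<Longrightarrow> e \<le> d \<Longrightarrow> close B d x y"
  by (force simp: close_def)

lemma close_refl: "e > 0 \<Longrightarrow> close A e x x"
  by (simp add: close_def)

lemma close_trans: "close A d x y \<Longrightarrow> close A e y z \<Longrightarrow> close A (d + e) x z"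
  unfolding close_def by (meson add_strict_mono dist_triangle le_less_trans)

lemma open_close:
  assumes "finite A"
  shows "open {y. close A e x y}"
proof -
  have "{y. close A e x y} = (\<Inter>i\<in>A. {y. dist (x i) (y i) < e})"
    by (auto simp: close_def)
  moreover have "open {y. dist (x i) (y i) < e}" for i
    by (intro open_Collect_less continuous_intros continuous_on_product_coordinates)
  ultimately show ?thesis
    using assms by auto
qed

lemma open_contains_close:
  fixes U :: "('i \<Rightarrow> 'a::metric_space) set"
  assumes "open U" "x \<in> U"
  obtains A e where "finite A" "e > 0" "\<And>y. close A e x y \<Longrightarrow> y \<in> U"
proof -
  obtain Y where Y: "x \<in> Pi\<^sub>E UNIV Y" "\<And>i. openin euclidean (Y i)"
      "finite {i. Y i \<noteq> topspace euclidean}" "Pi\<^sub>E UNIV Y \<subseteq> U"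
    using product_topology_open_contains_basis[of "\<lambda>_. euclidean" UNIV U x] assms
    unfolding open_fun_def by auto
  let ?A = "{i. Y i \<noteq> UNIV}"
  have fin: "finite ?A"
    using Y(3) by simp
  have "\<exists>e>0. ball (x i) e \<subseteq> Y i" for i
    using Y(1,2) by (meson PiE_mem UNIV_I open_contains_ball open_openin)
  then obtain d where d: "\<And>i. d i > 0" "\<And>i. ball (x i) (d i) \<subseteq> Y i"
    by metis
  \<comment> \<open>The 1 keeps \<open>Min\<close> away from the empty set.\<close>
  let ?e = "Min (insert 1 (d ` ?A))"
  have "?e > 0"
    using d fin by (subst Min_gr_iff) auto
  moreover have "y \<in> U" if "close ?A ?e x y" for y
  proof -
    have "y i \<in> Y i" for i
    proof (cases "i \<in> ?A")
      case True
      then have "dist (x i) (y i) < ?e" "?e \<le> d i"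
        using that fin by (auto simp: close_def intro!: Min_le)
      then show ?thesis
        using d(2)[of i] by force
    qed auto
    then show ?thesis
      using Y(4) by auto
  qed
  ultimately show ?thesis
    using that fin by blast
qed

text \<open>The Lebesgue number lemma for the product uniformity: neighbourhoods of half the size
  cover by compactness, and the triangle inequality recovers the full size. The bound
  \<open>R\<close> allows the coordinates to be confined to the arguments of a root.\<close>

lemma uniform_close:
  fixes X :: "('i \<Rightarrow> 'a::metric_space) set"
  assumes "compact X"
    and loc: "\<And>x. x \<in> X \<Longrightarrow>
      \<exists>A e. finite A \<and> A \<subseteq> R \<and> e > 0 \<and> (\<exists>V\<in>\<V>. \<forall>y\<in>X. close A e x y \<longrightarrow> y \<in> V)"
  obtains A e where "finite A" "A \<subseteq> R" "e > 0"
    "\<And>x. x \<in> X \<Longrightarrow> \<exists>V\<in>\<V>. \<forall>y\<in>X. close A e x y \<longrightarrow> y \<in> V"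
proof -
  define P where "P x q \<longleftrightarrow> finite (fst q) \<and> fst q \<subseteq> R \<and> fst (snd q) > 0 \<and> snd (snd q) \<in> \<V> \<and>
      (\<forall>y\<in>X. close (fst q) (fst (snd q)) x y \<longrightarrow> y \<in> snd (snd q))" for x q
  have "\<exists>q. P x q" if x: "x \<in> X" for x
  proof -
    obtain A e V where "finite A" "A \<subseteq> R" "e > 0" "V \<in> \<V>" "\<forall>y\<in>X. close A e x y \<longrightarrow> y \<in> V"
      using loc[OF x] by blast
    then have "P x (A, e, V)"
      by (simp add: P_def)
    then show ?thesis ..
  qed
  then obtain q where q: "\<And>x. x \<in> X \<Longrightarrow> P x (q x)"
    by metis
  define A e V where "A x = fst (q x)" and "e x = fst (snd (q x))" and "V x = snd (snd (q x))" for x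
  have AeV: "\<And>x. x \<in> X \<Longrightarrow> finite (A x)" "\<And>x. x \<in> X \<Longrightarrow> A x \<subseteq> R"
      "\<And>x. x \<in> X \<Longrightarrow> e x > 0" "\<And>x. x \<in> X \<Longrightarrow> V x \<in> \<V>"
      "\<And>x y. x \<in> X \<Longrightarrow> y \<in> X \<Longrightarrow> close (A x) (e x) x y \<Longrightarrow> y \<in> V x"
    using q unfolding P_def A_def e_def V_def by blast+
  let ?N = "\<lambda>x. {y. close (A x) (e x / 2) x y}"
  obtain D where D: "D \<subseteq> X" "finite D" "X \<subseteq> (\<Union>x\<in>D. ?N x)"
  proof (rule compactE_image[OF \<open>compact X\<close>, of X ?N])
    show "X \<subseteq> (\<Union>x\<in>X. ?N x)"
      using AeV(3) by (auto intro!: close_refl)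
  qed (use AeV(1) in \<open>auto intro: open_close\<close>)
  let ?A = "\<Union>x\<in>D. A x" and ?e = "Min (insert 1 ((\<lambda>x. e x / 2) ` D))"
  have e0: "?e > 0"
    using D AeV(3) by (subst Min_gr_iff) auto
  have loc': "\<exists>V\<in>\<V>. \<forall>y\<in>X. close ?A ?e x y \<longrightarrow> y \<in> V" if x: "x \<in> X" for x
  proof -
    obtain p where p: "p \<in> D" "close (A p) (e p / 2) p x"
      using D(3) x by auto
    have "y \<in> V p" if "y \<in> X" "close ?A ?e x y" for y
    proof -
      have "?e \<le> e p / 2"
        using D(2) p(1) by (intro Min_le) auto
      then have "close (A p) (e p / 2) x y"
        using that(2) p(1) by (auto intro: close_mono)
      then have "close (A p) (e p) p y"
        using close_trans[OF p(2)] by fastforce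
      then show ?thesis
        using AeV(5) D(1) p(1) that(1) by blast
    qed
    then show ?thesis
      using AeV(4) D(1) p(1) by blast
  qed
  have "finite ?A" "?A \<subseteq> R"
    using D AeV(1,2) by blast+
  then show ?thesis
    using e0 loc' by (rule that)
qed

lemma uniform_close_dist:
  fixes X :: "('i \<Rightarrow> 'a::metric_space) set" and h :: "('i \<Rightarrow> 'a) \<Rightarrow> 'b::metric_space"
  assumes "compact X"
    and loc: "\<And>x. x \<in> X \<Longrightarrow> \<exists>A e. finite A \<and> A \<subseteq> R \<and> e > 0 \<and>
      (\<forall>y\<in>X. close A e x y \<longrightarrow> dist (h x) (h y) < d / 2)"
  obtains A e where "finite A" "A \<subseteq> R" "e > 0"
    "\<And>x y. x \<in> X \<Longrightarrow> y \<in> X \<Longrightarrow> close A e x y \<Longrightarrow> dist (h x) (h y) < d"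
proof -
  let ?W = "\<lambda>x. {y. dist (h x) (h y) < d / 2}"
  have loc': "\<exists>A e. finite A \<and> A \<subseteq> R \<and> e > 0 \<and> (\<exists>V\<in>range ?W. \<forall>y\<in>X. close A e x y \<longrightarrow> y \<in> V)"
    if x: "x \<in> X" for x
  proof -
    obtain A e where "finite A" "A \<subseteq> R" "e > 0" "\<forall>y\<in>X. close A e x y \<longrightarrow> y \<in> ?W x"
      using loc[OF x] by auto
    then show ?thesis
      by (intro exI[of _ A] exI[of _ e] conjI bexI[of _ "?W x"]) auto
  qed
  obtain A e where Ae: "finite A" "A \<subseteq> R" "e > 0"
      "\<And>x. x \<in> X \<Longrightarrow> \<exists>V\<in>range ?W. \<forall>y\<in>X. close A e x y \<longrightarrow> y \<in> V"
    by (rule uniform_close[OF assms(1) loc']) blast+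
  have "dist (h x) (h y) < d" if xy: "x \<in> X" "y \<in> X" "close A e x y" for x y
  proof -
    obtain p where p: "\<And>y. y \<in> X \<Longrightarrow> close A e x y \<Longrightarrow> dist (h p) (h y) < d / 2"
      using Ae(4)[OF xy(1)] by auto
    have "dist (h p) (h x) < d / 2" "dist (h p) (h y) < d / 2"
      using p xy close_refl[OF Ae(3)] by auto
    then show ?thesis
      using dist_triangle_half_r by blast
  qed
  then show ?thesis
    using that Ae by blast
qed

lemma uniform_close_continuous:
  fixes X :: "('i \<Rightarrow> 'a::metric_space) set" and h :: "('i \<Rightarrow> 'a) \<Rightarrow> 'b::metric_space"
  assumes "compact X" "continuous_on UNIV h"
    and dep: "\<And>x y. (\<And>i. i \<in> R \<Longrightarrow> x i = y i) \<Longrightarrow> h x = h y" and "d > 0"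
  obtains A e where "finite A" "A \<subseteq> R" "e > 0"
    "\<And>x y. x \<in> X \<Longrightarrow> y \<in> X \<Longrightarrow> close A e x y \<Longrightarrow> dist (h x) (h y) < d"
proof -
  have loc: "\<exists>A e. finite A \<and> A \<subseteq> R \<and> e > 0 \<and>
      (\<forall>y\<in>X. close A e x y \<longrightarrow> dist (h x) (h y) < d / 2)" for x
  proof -
    let ?W = "{y. dist (h x) (h y) < d / 2}"
    have "open ?W"
      by (intro open_Collect_less continuous_intros assms(2))
    then obtain A e where Ae: "finite A" "e > 0" "\<And>y. close A e x y \<Longrightarrow> y \<in> ?W"
      using open_contains_close[of ?W x] \<open>d > 0\<close> by auto
    have "y \<in> ?W" if "close (A \<inter> R) e x y" for y
    proof -
      \<comment> \<open>Outside \<open>R\<close> the values of \<open>y\<close> may be overwritten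
        by those of \<open>x\<close> without changing \<open>h\<close>, so the constraints from
        \<open>A - R\<close> come for free.\<close>
      let ?y = "\<lambda>i. if i \<in> R then y i else x i"
      have "close A e x ?y"
        using that \<open>e > 0\<close> by (auto simp: close_def)
      moreover have "h ?y = h y"
        by (rule dep) simp
      ultimately show ?thesis
        using Ae(3)[of ?y] by simp
    qed
    then show ?thesis
      using Ae(1,2) by (intro exI[of _ "A \<inter> R"] exI[of _ e] conjI) auto
  qed
  show ?thesis
    by (rule uniform_close_dist[OF assms(1) loc]) (rule that)
qed

lemma uniform_close_continuous_on:
  fixes X :: "('i \<Rightarrow> 'a::metric_space) set" and h :: "('i \<Rightarrow> 'a) \<Rightarrow> 'b::metric_space"
  assumes "compact X" "continuous_on X h" "d > 0"
  obtains A e where "finite A" "e > 0"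
    "\<And>x y. x \<in> X \<Longrightarrow> y \<in> X \<Longrightarrow> close A e x y \<Longrightarrow> dist (h x) (h y) < d"
proof -
  have loc: "\<exists>A e. finite A \<and> A \<subseteq> UNIV \<and> e > 0 \<and>
      (\<forall>y\<in>X. close A e x y \<longrightarrow> dist (h x) (h y) < d / 2)" if x: "x \<in> X" for x
  proof -
    obtain T where T: "open T" "T \<inter> X = h -` ball (h x) (d / 2) \<inter> X"
      using assms(2)[unfolded continuous_on_open_invariant, rule_format, OF open_ball, of "h x" "d / 2"]
      by auto
    then have "x \<in> T"
      using x \<open>d > 0\<close> by auto
    then obtain A e where Ae: "finite A" "e > 0" "\<And>y. close A e x y \<Longrightarrow> y \<in> T"
      using open_contains_close[OF T(1)] by blast
    have "dist (h x) (h y) < d / 2" if "y \<in> X" "close A e x y" for y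
    proof -
      have "y \<in> T \<inter> X"
        using Ae(3) that by blast
      then show ?thesis
        by (simp add: T(2))
    qed
    then show ?thesis
      using Ae by blast
  qed
  show ?thesis
    by (rule uniform_close_dist[OF assms(1) loc]) (assumption, rule that)
qed

lemma lebesgue_close:
  fixes X :: "('i \<Rightarrow> 'a::metric_space) set"
  assumes "compact X" and cov: "finite_open_cover (top_of_set X) \<U>"
  obtains A e where "finite A" "e > 0"
    "\<And>x. x \<in> X \<Longrightarrow> \<exists>U\<in>\<U>. \<forall>y\<in>X. close A e x y \<longrightarrow> y \<in> U"
proof -
  have loc: "\<exists>A e. finite A \<and> A \<subseteq> UNIV \<and> e > 0 \<and> (\<exists>U\<in>\<U>. \<forall>y\<in>X. close A e x y \<longrightarrow> y \<in> U)"
    if "x \<in> X" for x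
  proof -
    have "x \<in> \<Union>\<U>"
      using cov that by (simp add: finite_open_cover_def)
    then obtain U where U: "U \<in> \<U>" "x \<in> U"
      by blast
    then obtain T where T: "open T" "U = X \<inter> T"
      using cov by (auto simp: finite_open_cover_def openin_open)
    obtain A e where Ae: "finite A" "e > 0" "\<And>y. close A e x y \<Longrightarrow> y \<in> T"
      using open_contains_close[of T x] T U by auto
    then show ?thesis
      using T U by (intro exI[of _ A] exI[of _ e] conjI bexI[of _ U]) auto
  qed
  show ?thesis
    by (rule uniform_close[OF assms(1) loc]) (assumption, rule that)
qed

section \<open>The tower of root extensions of the torus\<close>

text \<open>The exponent is \<open>Suc n\<close>, which excludes zeroth roots. Taking
  \<open>\<phi>\<close> on sequences of numbers, not on points of the space, keeps the recursion
  strictly positive: a function on the tower enters only through the countably many coordinates it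
  depends on.\<close>

datatype idx = Base nat | Root nat "nat \<Rightarrow> idx" "(nat \<Rightarrow> complex) \<Rightarrow> complex"

text \<open>Transitivity makes the set of indices not above a given one closed downwards, and
  provides maximal elements of finite sets.\<close>

definition sub :: "(idx \<times> idx) set" where
  "sub = {(\<iota> t, Root n \<iota> \<phi>) | n \<iota> \<phi> t. True}\<^sup>+"

lemma wf_sub: "wf sub"
proof -
  have "wf {(\<iota> t, Root n \<iota> \<phi>) | n \<iota> \<phi> t. True}"
  proof (rule wfUNIVI)
    fix P :: "idx \<Rightarrow> bool" and i
    assume step: "\<forall>x. (\<forall>y. (y, x) \<in> {(\<iota> t, Root n \<iota> \<phi>) | n \<iota> \<phi> t. True} \<longrightarrow> P y) \<longrightarrow> P x"
    show "P i"
      by (induction i) (rule step[rule_format], auto)+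
  qed
  then show ?thesis
    by (simp add: sub_def wf_trancl)
qed

lemma trans_sub: "trans sub"
  by (simp add: sub_def)

lemma sub_irrefl: "(i, i) \<notin> sub"
  using wf_sub by (meson wf_not_refl)

lemma sub_RootI: "(\<iota> t, Root n \<iota> \<phi>) \<in> sub"
  unfolding sub_def by blast

lemma not_sub_Base [simp]: "(i, Base j) \<notin> sub"
proof
  assume "(i, Base j) \<in> sub"
  then show False
    unfolding sub_def by (cases rule: trancl.cases) auto
qed

text \<open>The bound 1 keeps every coordinate in the closed unit disc, so that Tychonoff applies;
  other bounded functions are rescaled.\<close>

definition admissible :: "((nat \<Rightarrow> complex) \<Rightarrow> complex) \<Rightarrow> bool" where
  "admissible \<phi> \<longleftrightarrow> continuous_on UNIV \<phi> \<and> (\<forall>u. norm (\<phi> u) \<le> 1)"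

text \<open>An index with inadmissible \<open>\<phi>\<close> contributes the coordinate 0.\<close>

definition rhs :: "(nat \<Rightarrow> idx) \<Rightarrow> ((nat \<Rightarrow> complex) \<Rightarrow> complex) \<Rightarrow> (idx \<Rightarrow> complex) \<Rightarrow> complex" where
  "rhs \<iota> \<phi> x = (if admissible \<phi> then \<phi> (x \<circ> \<iota>) else 0)"

lemma continuous_on_reindex:
  "continuous_on S (\<lambda>x :: 'i \<Rightarrow> 'a::topological_space. x \<circ> \<iota>)"
  by (intro continuous_on_coordinatewise_then_product) 
    (auto simp: comp_def intro: continuous_on_subset[OF continuous_on_product_coordinates])

lemma continuous_on_rhs: "continuous_on S (rhs \<iota> \<phi>)"
proof (cases "admissible \<phi>")
  case True
  have "continuous_on S (\<lambda>x. \<phi> (x \<circ> \<iota>))"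
    by (rule continuous_on_compose2[OF _ continuous_on_reindex, of UNIV])
      (use True in \<open>auto simp: admissible_def\<close>)
  then show ?thesis
    using True by (simp add: rhs_def[abs_def])
qed (simp add: rhs_def[abs_def])

lemma norm_rhs_le: "norm (rhs \<iota> \<phi> x) \<le> 1"
  by (simp add: rhs_def admissible_def)

lemma rhs_cong: "(\<And>t. x (\<iota> t) = y (\<iota> t)) \<Longrightarrow> rhs \<iota> \<phi> x = rhs \<iota> \<phi> y"
  by (simp add: rhs_def comp_def)

text \<open>Pinning the surplus coordinates \<open>Base j\<close> with \<open>j \<ge> m\<close> to 0
  lets one index type serve every \<open>m\<close>.\<close>

fun eqn :: "nat \<Rightarrow> (idx \<Rightarrow> complex) \<Rightarrow> idx \<Rightarrow> bool" where
  "eqn m x (Base j) \<longleftrightarrow> norm (x (Base j)) = (if j < m then 1 else 0)"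
| "eqn m x (Root n \<iota> \<phi>) \<longleftrightarrow> x (Root n \<iota> \<phi>) ^ Suc n = rhs \<iota> \<phi> x"

definition tower :: "nat \<Rightarrow> (idx \<Rightarrow> complex) set" where
  "tower m = {x. \<forall>i. eqn m x i}"

lemma tower_Base: "x \<in> tower m \<Longrightarrow> norm (x (Base j)) = (if j < m then 1 else 0)"
  unfolding tower_def by (metis (mono_tags) eqn.simps(1) mem_Collect_eq)

lemma tower_Root: "x \<in> tower m \<Longrightarrow> x (Root n \<iota> \<phi>) ^ Suc n = rhs \<iota> \<phi> x"
  unfolding tower_def by (metis (mono_tags) eqn.simps(2) mem_Collect_eq)

lemma norm_tower_le:
  assumes "x \<in> tower m"
  shows "norm (x i) \<le> 1"
proof (cases i)
  case (Base j)
  then show ?thesis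
    using tower_Base[OF assms] by simp
next
  case (Root n \<iota> \<phi>)
  have "norm (x i) ^ Suc n \<le> 1"
    unfolding norm_power[symmetric] Root tower_Root[OF assms] by (rule norm_rhs_le)
  then show ?thesis
    by (metis norm_ge_zero not_le one_less_power zero_less_Suc)
qed

lemma closed_eqn: "closed {x. eqn m x i}"
proof (cases i)
  case (Base j)
  then show ?thesis
    by (auto intro!: closed_Collect_eq continuous_intros)
next
  case (Root n \<iota> \<phi>)
  have "closed {x. x (Root n \<iota> \<phi>) ^ Suc n = rhs \<iota> \<phi> x}"
    by (intro closed_Collect_eq continuous_on_power continuous_on_product_coordinates
        continuous_on_rhs)
  then show ?thesis
    using Root by simp
qed

lemma compact_tower: "compact (tower m)"
proof -
  have "compactin (product_topology (\<lambda>_. euclidean) UNIV) (PiE UNIV (\<lambda>_::idx. cball (0::complex) 1))"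
    by (simp add: compactin_PiE)
  then have "compact (PiE UNIV (\<lambda>_::idx. cball (0::complex) 1))"
    by (simp add: euclidean_product_topology)
  moreover have "tower m = (\<Inter>i. {x. eqn m x i})"
    by (auto simp: tower_def)
  then have "closed (tower m)"
    using closed_eqn by auto
  moreover have "tower m \<subseteq> PiE UNIV (\<lambda>_. cball 0 1)"
    using norm_tower_le by auto
  ultimately show ?thesis
    by (metis compact_Int_closed inf.absorb_iff2)
qed

text \<open>A partial solution on a downward closed set extends by well-founded recursion, since
  complex numbers have roots and an equation mentions only smaller indices besides its own.\<close>

lemma tower_extend:
  assumes down: "\<And>i k. (i, k) \<in> sub \<Longrightarrow> k \<in> D \<Longrightarrow> i \<in> D" and "range Base \<subseteq> D"
    and eqn: "\<And>k. k \<in> D \<Longrightarrow> eqn m x k"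
  obtains y where "y \<in> tower m" "\<And>k. k \<in> D \<Longrightarrow> y k = x k"
proof -
  define F where "F g k = (if k \<in> D then x k
      else case k of Root n \<iota> \<phi> \<Rightarrow> (SOME z. z ^ Suc n = rhs \<iota> \<phi> g) | _ \<Rightarrow> 0)" for g k
  have "adm_wf sub F"
    unfolding adm_wf_def F_def by (auto split: idx.split simp: sub_RootI cong: rhs_cong)
  then have y: "wfrec sub F k = F (wfrec sub F) k" for k
    using wfrec_fixpoint[OF wf_sub] by metis
  let ?y = "wfrec sub F"
  have agree: "?y k = x k" if "k \<in> D" for k
    using that y[of k] by (simp add: F_def)
  have "eqn m ?y k" for k
  proof (cases "k \<in> D")
    case True
    have "eqn m x k"
      using eqn True .
    moreover have "rhs \<iota> \<phi> ?y = rhs \<iota> \<phi> x" if "k = Root n \<iota> \<phi>" for n \<iota> \<phi>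
      using agree down[OF sub_RootI, of n \<iota> \<phi>] True that by (intro rhs_cong) auto
    ultimately show ?thesis
      using agree[OF True] by (cases k) auto
  next
    case False
    then obtain n \<iota> \<phi> where k: "k = Root n \<iota> \<phi>"
      using assms(2) by (cases k) auto
    have "\<exists>z. z ^ Suc n = rhs \<iota> \<phi> ?y"
      using exists_complex_root[of "Suc n"] by (metis nat.distinct(1))
    then have "(SOME z. z ^ Suc n = rhs \<iota> \<phi> ?y) ^ Suc n = rhs \<iota> \<phi> ?y"
      by (rule someI_ex)
    then show ?thesis
      using y[of k] False by (simp add: k F_def del: power_Suc)
  qed
  then show ?thesis
    using that agree by (auto simp: tower_def)
qed

text \<open>Switching to another branch of one root. The indices not above it form a downward closed
  set on which the modified point still solves all equations; only coordinates above the root have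
  to be chosen anew.\<close>

lemma tower_lift:
  assumes "x \<in> tower m" "z ^ Suc n = rhs \<iota> \<phi> x"
  obtains y where "y \<in> tower m" "y (Root n \<iota> \<phi>) = z"
    "\<And>k. k \<noteq> Root n \<iota> \<phi> \<Longrightarrow> (Root n \<iota> \<phi>, k) \<notin> sub \<Longrightarrow> y k = x k"
proof -
  let ?i = "Root n \<iota> \<phi>"
  let ?x = "x(?i := z)"
  have down: "k \<in> - {k. (?i, k) \<in> sub}" if "(k, l) \<in> sub" "l \<in> - {k. (?i, k) \<in> sub}" for k l
    using that trans_sub by (auto dest: transD)
  have "eqn m ?x k" if k: "k \<in> - {k. (?i, k) \<in> sub}" for k
  proof (cases k)
    case (Base j)
    then show ?thesis
      using tower_Base[OF assms(1)] by simp
  next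
    case (Root n' \<iota>' \<phi>')
    have "rhs \<iota>' \<phi>' ?x = rhs \<iota>' \<phi>' x"
      using k sub_RootI[of \<iota>' _ n' \<phi>'] unfolding Root by (intro rhs_cong) (metis ComplD fun_upd_other mem_Collect_eq)
    then show ?thesis
      using tower_Root[OF assms(1), of n' \<iota>' \<phi>'] assms(2) Root by (auto simp del: power_Suc)
  qed
  moreover have "range Base \<subseteq> - {k. (?i, k) \<in> sub}"
    by auto
  ultimately obtain y where "y \<in> tower m" "\<And>k. k \<in> - {k. (?i, k) \<in> sub} \<Longrightarrow> y k = ?x k"
    using tower_extend[of "- {k. (?i, k) \<in> sub}" m ?x] down by blast
  then show ?thesis
    using that sub_irrefl[of ?i] by auto
qed

lemma tower_over_torus:
  assumes "\<And>j. norm (u j) = (if j < m then 1 else 0)"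
  obtains y where "y \<in> tower m" "\<And>j. y (Base j) = u j"
proof -
  let ?x = "\<lambda>i. case i of Base j \<Rightarrow> u j | _ \<Rightarrow> 0"
  show ?thesis
    by (rule tower_extend[of "range Base" m ?x]) (use assms that in auto)
qed

section \<open>Roots\<close>

text \<open>Each tolerance \<open>1 / (k + 1)\<close> is controlled by finitely many coordinates, so
  countably many determine \<open>h\<close>. The induced function on the projection is continuous by
  compactness, and Tietze extends it to all sequences with the same bound.\<close>

lemma tower_factor:
  fixes h :: "(idx \<Rightarrow> complex) \<Rightarrow> complex"
  assumes h: "continuous_on (tower m) h" and bound: "\<And>x. x \<in> tower m \<Longrightarrow> norm (h x) \<le> 1"
  obtains \<iota> \<phi> where "admissible \<phi>" "\<And>x. x \<in> tower m \<Longrightarrow> h x = \<phi> (x \<circ> \<iota>)"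
proof -
  have "\<exists>A. finite A \<and> (\<exists>e>0. \<forall>x\<in>tower m. \<forall>y\<in>tower m.
      close A e x y \<longrightarrow> dist (h x) (h y) < inverse (Suc k))" for k
    using uniform_close_continuous_on[OF compact_tower h, of "inverse (Suc k)"]
    by (metis inverse_positive_iff_positive of_nat_0_less_iff zero_less_Suc)
  then obtain A where A: "\<And>k. finite (A k)" "\<And>k. \<exists>e>0. \<forall>x\<in>tower m. \<forall>y\<in>tower m.
      close (A k) e x y \<longrightarrow> dist (h x) (h y) < inverse (Suc k)"
    by metis
  \<comment> \<open>\<open>Base 0\<close> makes the countable set nonempty, as its enumeration by
    \<open>from_nat_into\<close> requires.\<close>
  let ?C = "insert (Base 0) (\<Union>k. A k)"
  have "countable ?C"
    using A(1) by (auto intro: countable_finite)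
  then have range: "range (from_nat_into ?C) = ?C"
    by (simp add: range_from_nat_into)
  define \<iota> where "\<iota> = from_nat_into ?C"
  have eq: "h x = h y" if xy: "x \<in> tower m" "y \<in> tower m" "x \<circ> \<iota> = y \<circ> \<iota>" for x y
  proof -
    have "x i = y i" if "i \<in> A k" for i k
    proof -
      have "i \<in> range \<iota>"
        using that range by (auto simp: \<iota>_def)
      then show ?thesis
        using xy(3) by (metis comp_apply imageE)
    qed
    then have "close (A k) e x y" if "e > 0" for k e
      using that by (auto simp: close_def)
    then have "dist (h x) (h y) < inverse (Suc k)" for k
      using A(2) xy by blast
    then show ?thesis
      by (metis dist_eq_0_iff dist_nz not_less_iff_gr_or_eq reals_Archimedean)
  qed
  define r where "r x = x \<circ> \<iota>" for x :: "idx \<Rightarrow> complex"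
  have r: "continuous_on S r" for S
    unfolding r_def[abs_def] by (rule continuous_on_reindex)
  have inv: "h (inv_into (tower m) r (r x)) = h x" if "x \<in> tower m" for x
    using eq[of "inv_into (tower m) r (r x)" x] that inv_into_into[of "r x" r "tower m"]
      f_inv_into_f[of "r x" r "tower m"] by (auto simp: r_def)
  let ?\<psi> = "\<lambda>u. h (inv_into (tower m) r u)"
  have "\<exists>A. closed A \<and> A \<inter> r ` tower m = ?\<psi> -` B \<inter> r ` tower m" if B: "closed B" for B
  proof -
    obtain T where T: "closed T" "T \<inter> tower m = h -` B \<inter> tower m"
      using h[unfolded continuous_on_closed_invariant, rule_format, OF B] by auto
    \<comment> \<open>Compactness makes the projection a closed map, hence a quotient map onto its
      image.\<close>
    have "compact (r ` (T \<inter> tower m))"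
      using T(1) compact_tower by (intro compact_continuous_image r closed_Int_compact)
    then have "closed (r ` (T \<inter> tower m))"
      by (rule compact_imp_closed)
    moreover have "r ` (T \<inter> tower m) \<inter> r ` tower m = ?\<psi> -` B \<inter> r ` tower m"
      unfolding T(2) using inv by force
    ultimately show ?thesis
      by blast
  qed
  then have cont: "continuous_on (r ` tower m) ?\<psi>"
    unfolding continuous_on_closed_invariant by blast
  have "closedin (top_of_set UNIV) (r ` tower m)"
    using compact_continuous_image[OF r compact_tower] by (simp add: compact_imp_closed)
  moreover have "norm (?\<psi> u) \<le> 1" if "u \<in> r ` tower m" for u
    using that bound inv by auto
  ultimately obtain \<phi> where \<phi>: "continuous_on UNIV \<phi>" "\<And>u. u \<in> r ` tower m \<Longrightarrow> \<phi> u = ?\<psi> u"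
      "\<And>u. norm (\<phi> u) \<le> 1"
    using Tietze[OF cont, of UNIV 1] by auto
  show ?thesis
  proof (rule that[of \<phi> \<iota>])
    show "admissible \<phi>"
      using \<phi> by (simp add: admissible_def)
    show "h x = \<phi> (x \<circ> \<iota>)" if "x \<in> tower m" for x
      using \<phi>(2)[of "r x"] inv[OF that] that by (simp add: r_def)
  qed
qed

lemma root_closed_tower:
  assumes "n \<ge> 1"
  shows "root_closed n (top_of_set (tower m))"
  unfolding root_closed_def
proof
  fix f assume "f \<in> bounded_cfuns (top_of_set (tower m))"
  then have f: "continuous_on (tower m) f" "bounded (f ` tower m)"
    by (auto simp: bounded_cfuns_def)
  obtain C where C: "C > 0" "\<And>x. x \<in> tower m \<Longrightarrow> norm (f x) \<le> C"
    using f(2) unfolding bounded_pos by auto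
  let ?h = "\<lambda>x. f x / of_real C"
  have "continuous_on (tower m) ?h"
    using C(1) by (intro continuous_intros f) auto
  moreover have "norm (?h x) \<le> 1" if "x \<in> tower m" for x
    using C(2)[OF that] C(1) by (simp add: norm_divide)
  ultimately obtain \<iota> \<phi> where \<phi>: "admissible \<phi>" "\<And>x. x \<in> tower m \<Longrightarrow> ?h x = \<phi> (x \<circ> \<iota>)"
    using tower_factor[of m ?h] by blast
  obtain p where p: "n = Suc p"
    using assms by (cases n) auto
  \<comment> \<open>The new coordinate is itself the root of the rescaled function; the real factor
    undoes the scaling.\<close>
  let ?g = "\<lambda>x. of_real (root n C) * x (Root p \<iota> \<phi>) :: complex"
  show "\<exists>g\<in>bounded_cfuns (top_of_set (tower m)). \<forall>x\<in>topspace (top_of_set (tower m)). f x = g x ^ n"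
  proof (rule bexI[of _ ?g])
    have "?g x ^ n = f x" if x: "x \<in> tower m" for x
    proof -
      have "x (Root p \<iota> \<phi>) ^ n = ?h x"
        unfolding p tower_Root[OF x] using \<phi> x by (simp add: rhs_def)
      moreover have "root n C ^ n = C"
        using C(1) assms by simp
      ultimately show ?thesis
        using C(1) by (simp add: power_mult_distrib flip: of_real_power)
    qed
    then show "\<forall>x\<in>topspace (top_of_set (tower m)). f x = ?g x ^ n"
      by simp
    have "norm (?g x) \<le> root n C" if "x \<in> tower m" for x
      using norm_tower_le[OF that] real_root_ge_zero[of C n] C(1) by (simp add: norm_mult mult_left_le)
    then have "bounded (?g ` tower m)"
      unfolding bounded_iff by blast
    moreover have "continuous_on (tower m) ?g"
      by (intro continuous_on_mult_left continuous_on_subset[OF continuous_on_product_coordinates]) auto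
    ultimately show "?g \<in> bounded_cfuns (top_of_set (tower m))"
      by (simp add: bounded_cfuns_def)
  qed
qed

section \<open>Complex roots near 1\<close>

text \<open>The principal branch. The relevant arguments are ratios of nearby values, which lie in
  the right half-plane; there it is continuous and multiplicative.\<close>

definition rt :: "nat \<Rightarrow> complex \<Rightarrow> complex" where
  "rt n w = exp (Ln w / of_nat (Suc n))"

lemma rt_power: "w \<noteq> 0 \<Longrightarrow> rt n w ^ Suc n = w"
  by (simp add: rt_def flip: exp_of_nat_mult del: power_Suc of_nat_Suc)

lemma rt_nonzero [simp]: "rt n w \<noteq> 0"
  by (simp add: rt_def)

lemma rt_1 [simp]: "rt n 1 = 1"
  by (simp add: rt_def)

lemma Re_pos_near_1: "norm (w - 1) < 1 \<Longrightarrow> Re w > 0"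
  using complex_Re_le_cmod[of "1 - w"] by (simp add: norm_minus_commute)

text \<open>Both logarithms have imaginary part below pi / 2 in absolute value, so their sum stays
  within the principal range.\<close>

lemma Ln_mult_Re_pos:
  assumes "Re w > 0" "Re z > 0"
  shows "Ln (w * z) = Ln w + Ln z"
  using Re_Ln_pos_lt_imp[OF assms(1)] Re_Ln_pos_lt_imp[OF assms(2)] assms
  by (intro Ln_times_simple) auto

lemma rt_mult: "Re w > 0 \<Longrightarrow> Re z > 0 \<Longrightarrow> rt n (w * z) = rt n w * rt n z"
  by (simp add: rt_def Ln_mult_Re_pos add_divide_distrib exp_add)

lemma Re_pos_notin_nonpos: "Re w > 0 \<Longrightarrow> w \<notin> \<real>\<^sub>\<le>\<^sub>0"
  by (simp add: complex_nonpos_Reals_iff)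

lemma continuous_on_rt:
  assumes "continuous_on S g" "\<And>x. x \<in> S \<Longrightarrow> Re (g x) > 0"
  shows "continuous_on S (\<lambda>x. rt n (g x))"
  unfolding rt_def using assms(2) by (intro continuous_intros assms(1)) (auto dest: Re_pos_notin_nonpos simp del: of_nat_Suc)

lemma rt_near_1:
  assumes "e > 0"
  obtains d where "d > 0" "d \<le> 1 / 2" "\<And>w. norm (w - 1) < d \<Longrightarrow> norm (rt n w - 1) < e"
proof -
  have "continuous_on (ball 1 1) (rt n)"
    using continuous_on_rt[of "ball 1 1" "\<lambda>x. x"] Re_pos_near_1
    by (force simp: dist_norm norm_minus_commute)
  then have "isCont (rt n) 1"
    by (simp add: continuous_on_eq_continuous_at)
  then obtain d where "d > 0" "\<And>w. dist w 1 < d \<Longrightarrow> dist (rt n w) (rt n 1) < e"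
    using assms unfolding continuous_at_eps_delta by blast
  then show ?thesis
    by (intro that[of "min d (1 / 2)"]) (auto simp: dist_norm)
qed

lemma norm_cis_diff_le: "norm (cis a - cis b) \<le> \<bar>a - b\<bar>"
proof -
  have "cis a - cis b = cis b * (exp (\<i> * of_real (a - b)) - 1)"
    by (simp add: right_diff_distrib cis_mult del: of_real_diff flip: cis_conv_exp)
  then have "norm (cis a - cis b) = 2 * \<bar>sin ((a - b) / 2)\<bar>"
    by (simp only: norm_mult norm_cis dist_exp_i_1)
  then show ?thesis
    using abs_sin_x_le_abs_x[of "(a - b) / 2"] by simp
qed

section \<open>The dimension is at most m\<close>

text \<open>The multiset order makes replacing one root by finitely many of its arguments a descent,
  however many there are. Choosing a maximal root ensures that no other coordinate in
  \<open>A\<close> depends on it, so that its branch can be switched without disturbing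
  them.\<close>

lemma finite_sub_induct [consumes 1, case_names Base Root]:
  assumes "finite A"
    and base: "\<And>A. finite A \<Longrightarrow> A \<subseteq> range Base \<Longrightarrow> P A"
    and step: "\<And>A n \<iota> \<phi>. finite A \<Longrightarrow> Root n \<iota> \<phi> \<in> A \<Longrightarrow> (\<And>k. k \<in> A \<Longrightarrow> (Root n \<iota> \<phi>, k) \<notin> sub) \<Longrightarrow>
      (\<And>B. finite B \<Longrightarrow> B \<subseteq> range \<iota> \<Longrightarrow> P (A - {Root n \<iota> \<phi>} \<union> B)) \<Longrightarrow> P A"
  shows "P A"
  using assms(1)
proof (induction "mset_set A" arbitrary: A rule: wf_induct_rule[OF wf_mult[OF wf_sub]])
  case (1 A)
  show ?case
  proof (cases "A \<subseteq> range Base")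
    case False
    have "asymp_on (A - range Base) (\<lambda>i k. (i, k) \<in> sub)" "transp_on (A - range Base) (\<lambda>i k. (i, k) \<in> sub)"
      using trans_sub sub_irrefl by (auto intro!: asymp_onI transp_onI dest: transD)
    then obtain i where i: "i \<in> A - range Base"
        "\<And>k. k \<in> A - range Base \<Longrightarrow> k \<noteq> i \<Longrightarrow> (i, k) \<notin> sub"
      using Finite_Set.bex_max_element[of "A - range Base" "\<lambda>i k. (i, k) \<in> sub"] False 1(2) by blast
    then obtain n \<iota> \<phi> where i': "i = Root n \<iota> \<phi>"
      by (cases i) auto
    show ?thesis
    proof (rule step)
      show "(Root n \<iota> \<phi>, k) \<notin> sub" if "k \<in> A" for k
        using i that sub_irrefl[of i] by (cases k) (auto simp: i')
      show "P (A - {Root n \<iota> \<phi>} \<union> B)" if B: "finite B" "B \<subseteq> range \<iota>" for B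
      proof (rule 1(1))
        \<comment> \<open>Arguments already in \<open>A\<close> are left out so that the two
          multisets add up to the multiset of a set.\<close>
        let ?A = "A - {i}" and ?B = "B - (A - {i})"
        have "(k, i) \<in> sub" if k: "k \<in> B" for k
        proof -
          obtain t where "k = \<iota> t"
            using k B(2) by blast
          then show ?thesis
            by (simp add: i' sub_RootI)
        qed
        then have "\<forall>k\<in>#mset_set ?B. \<exists>j\<in>#{#i#}. (k, j) \<in> sub"
          using B(1) by simp
        then have "(mset_set ?A + mset_set ?B, mset_set ?A + {#i#}) \<in> Multiset.mult sub"
          by (intro one_step_implies_mult) auto
        moreover have "mset_set ?A + mset_set ?B = mset_set (?A \<union> ?B)"
          using B(1) 1(2) by (subst mset_set_Union) auto
        moreover have "mset_set ?A + {#i#} = mset_set A"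
          using i(1) 1(2) by (simp add: mset_set.remove[of A i])
        ultimately show "(mset_set (A - {Root n \<iota> \<phi>} \<union> B), mset_set A) \<in> Multiset.mult sub"
          by (simp add: i')
      qed (use B(1) 1(2) in auto)
    qed (use i(1) 1(2) in \<open>auto simp: i'\<close>)
  qed (use base 1(2) in blast)
qed

text \<open>A bound on the size of the members replaces the refinement of a given cover: by
  \<open>lebesgue_close\<close> a fine enough cover refines any given finite open one, and size is
  what passes through the induction on \<open>A\<close>.\<close>

definition fine_cover :: "nat \<Rightarrow> idx set \<Rightarrow> real \<Rightarrow> (idx \<Rightarrow> complex) set set \<Rightarrow> bool" where
  "fine_cover m A e \<V> \<longleftrightarrow> finite_open_cover (top_of_set (tower m)) \<V> \<and>
     (\<forall>V\<in>\<V>. \<forall>x\<in>V. \<forall>y\<in>V. close A e x y) \<and>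
     (\<forall>x\<in>tower m. card {V\<in>\<V>. x \<in> V} \<le> m + 1)"

text \<open>Over a small set, a root either splits into disjoint continuous branches or is itself small.\<close>

lemma fine_cover_root:
  assumes e: "e > 0" and V: "fine_cover m (A \<union> B) (min e eB) \<V>"
    and d: "d \<le> 1 / 2" "\<And>w. norm (w - 1) < d \<Longrightarrow> norm (rt n w - 1) < e / 2"
    and \<rho>: "\<rho> > 0" "2 * \<rho> \<le> (e / 2) ^ Suc n"
    and B: "\<And>x y. x \<in> tower m \<Longrightarrow> y \<in> tower m \<Longrightarrow> close B eB x y \<Longrightarrow>
      dist (rhs \<iota> \<phi> x) (rhs \<iota> \<phi> y) < d * \<rho>"
  shows "\<exists>\<W>. fine_cover m (insert (Root n \<iota> \<phi>) A) e \<W>"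
proof -
  let ?i = "Root n \<iota> \<phi>" and ?X = "tower m"
  define f where "f = rhs \<iota> \<phi>"
  \<comment> \<open>Near the zeros of \<open>f\<close> a member is kept whole; elsewhere it is cut
    into the branches of the root.\<close>
  define low where "low V \<longleftrightarrow> (\<exists>x\<in>V. norm (f x) < \<rho>)" for V
  define p where "p V = (SOME x. x \<in> V)" for V :: "(idx \<Rightarrow> complex) set"
  \<comment> \<open>The value at \<open>p V\<close> of the branch through \<open>y\<close>, obtained
    by dividing out the principal root of the ratio. Away from the zeros it is one of finitely many
    roots of \<open>f (p V)\<close> and continuous, so its level sets are open in
    \<open>V\<close>.\<close>
  define s where "s V y = y ?i / rt n (f y / f (p V))" for V y
  define piece where "piece V x = (if low V then V else {y\<in>V. s V y = s V x})" for V x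
  let ?W = "{piece V x | V x. V \<in> \<V> \<and> x \<in> V}"
  have finV: "finite \<V>" and openV: "\<And>V. V \<in> \<V> \<Longrightarrow> openin (top_of_set ?X) V" and coverV: "\<Union>\<V> = ?X"
    and card: "\<And>x. x \<in> ?X \<Longrightarrow> card {V\<in>\<V>. x \<in> V} \<le> m + 1"
    using V by (auto simp: fine_cover_def finite_open_cover_def)
  have clV: "close (A \<union> B) (min e eB) x y" if "V \<in> \<V>" "x \<in> V" "y \<in> V" for V x y
    using V that by (auto simp: fine_cover_def)
  have VX: "V \<subseteq> ?X" if "V \<in> \<V>" for V
    using coverV that by blast
  have root: "x ?i ^ Suc n = f x" if "x \<in> ?X" for x
    using tower_Root[OF that] by (simp add: f_def)
  have fV: "dist (f x) (f y) < d * \<rho>" if "V \<in> \<V>" "x \<in> V" "y \<in> V" for V x y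
    unfolding f_def using that VX[OF that(1)] clV[OF that]
    by (intro B) (auto elim!: close_mono)
  have high: "norm (f y / f (p V) - 1) < d \<and> Re (f y / f (p V)) > 0 \<and> f (p V) \<noteq> 0 \<and> f y \<noteq> 0"
    if V: "V \<in> \<V>" "\<not> low V" "y \<in> V" for V y
  proof -
    have "p V \<in> V"
      using someI[of "\<lambda>x. x \<in> V", OF V(3)] by (simp add: p_def)
    then have *: "norm (f (p V)) \<ge> \<rho>" "norm (f y) \<ge> \<rho>" "dist (f y) (f (p V)) < d * \<rho>"
      using V fV by (auto simp: low_def not_less)
    moreover have "f (p V) \<noteq> 0"
      using *(1) \<rho>(1) by auto
    then have "f y / f (p V) - 1 = (f y - f (p V)) / f (p V)"
      by (simp add: diff_divide_distrib)
    moreover have "d * \<rho> \<le> d * norm (f (p V))"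
      using *(1) *(3) \<rho>(1) by (intro mult_left_mono) (auto simp: zero_less_mult_iff intro: less_imp_le dest: le_less_trans[OF zero_le_dist])
    ultimately have "norm (f y / f (p V) - 1) < d"
      using \<rho>(1) by (auto simp: norm_divide dist_norm divide_simps)
    then show ?thesis
      using d(1) * \<rho>(1) Re_pos_near_1[of "f y / f (p V)"] by auto
  qed
  have s_root: "s V y ^ Suc n = f (p V)" if "V \<in> \<V>" "\<not> low V" "y \<in> V" for V y
    using high[OF that] root[of y] VX[OF that(1)] that(3)
    by (auto simp: s_def power_divide rt_power field_simps simp del: power_Suc)
  have finite_roots: "finite {z. z ^ Suc n = f (p V)}" for V
    by (rule finite_nth_roots) simp
  have "finite ?W"
  proof -
    have "?W \<subseteq> (\<Union>V\<in>\<V>. insert V ((\<lambda>z. {y\<in>V. s V y = z}) ` {z. z ^ Suc n = f (p V)}))"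
      using s_root by (auto simp: piece_def simp del: power_Suc)
    moreover have "finite \<dots>"
      using finV finite_roots by blast
    ultimately show ?thesis
      by (rule finite_subset)
  qed
  moreover have "openin (top_of_set ?X) (piece V x)" if V: "V \<in> \<V>" "x \<in> V" for V x
  proof (cases "low V")
    case False
    let ?Z = "{z. z ^ Suc n = f (p V)} - {s V x}"
    have "continuous_on V (s V)"
      unfolding s_def f_def
      by (intro continuous_on_divide continuous_on_rt continuous_on_rhs continuous_on_const
            continuous_on_subset[OF continuous_on_product_coordinates])
        (use high[OF V(1) False] in \<open>auto simp: f_def\<close>)
    moreover have "open (- ?Z)"
      using finite_roots[of V] by (intro open_Compl finite_imp_closed) auto
    ultimately have "openin (top_of_set V) (V \<inter> s V -` (- ?Z))"
      by (rule continuous_openin_preimage_gen)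
    moreover have "V \<inter> s V -` (- ?Z) = piece V x"
      using False s_root[OF V(1) False] by (auto simp: piece_def simp del: power_Suc)
    ultimately show ?thesis
      using openin_trans openV[OF V(1)] by metis
  qed (use V openV in \<open>simp add: piece_def\<close>)
  moreover have in_piece: "x \<in> piece V x" "piece V x \<subseteq> V" if "x \<in> V" for x V
    using that by (auto simp: piece_def)
  have "\<Union>?W = ?X"
  proof (intro equalityI subsetI)
    fix x assume "x \<in> \<Union>?W"
    then obtain V q where "V \<in> \<V>" "q \<in> V" "x \<in> piece V q"
      by auto
    then show "x \<in> ?X"
      using in_piece(2) VX by blast
  next
    fix x assume "x \<in> ?X"
    then obtain V where "V \<in> \<V>" "x \<in> V"
      using coverV by blast
    then show "x \<in> \<Union>?W"
      using in_piece(1) by blast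
  qed
  moreover have "card {W\<in>?W. x \<in> W} \<le> m + 1" if x: "x \<in> ?X" for x
  proof -
    \<comment> \<open>A point lies in just one piece of each \<open>V\<close> containing it, hence
      the order of the cover does not grow.\<close>
    have "piece V y = piece V x" if "x \<in> piece V y" for V y
      using that by (auto simp: piece_def split: if_splits)
    then have "{W\<in>?W. x \<in> W} \<subseteq> (\<lambda>V. piece V x) ` {V\<in>\<V>. x \<in> V}"
      using in_piece by blast
    then have "card {W\<in>?W. x \<in> W} \<le> card {V\<in>\<V>. x \<in> V}"
      using finV by (intro surj_card_le) auto
    then show ?thesis
      using card[OF x] by simp
  qed
  moreover have "close (insert ?i A) e x y" if W: "W \<in> ?W" "x \<in> W" "y \<in> W" for W x y
  proof -
    obtain V q where V: "V \<in> \<V>" "q \<in> V" "W = piece V q"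
      using W(1) by auto
    have xy: "x \<in> V" "y \<in> V" "x \<in> ?X" "y \<in> ?X"
      using W(2,3) V(3) VX[OF V(1)] in_piece(2)[OF V(2)] by blast+
    have "dist (x ?i) (y ?i) < e"
    proof (cases "low V")
      case True
      then obtain q where q: "q \<in> V" "norm (f q) < \<rho>"
        by (auto simp: low_def)
      \<comment> \<open>One value below \<rho> and a spread of at most \<rho> / 2 put all values of
        \<open>f\<close> on \<open>V\<close> below \<open>2 * \<rho>\<close>, whose roots are below
        \<open>e / 2\<close>.\<close>
      have "norm (z ?i) < e / 2" if z: "z \<in> V" for z
      proof -
        have "norm (f z) \<le> norm (f q) + dist (f z) (f q)"
          by (metis dist_norm norm_triangle_sub)
        moreover have "dist (f z) (f q) < d * \<rho>"
          using fV[OF V(1) z q(1)] .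
        moreover have "d * \<rho> \<le> 1 / 2 * \<rho>"
          using d(1) \<rho>(1) by (intro mult_right_mono) auto
        ultimately have "norm (f z) < 2 * \<rho>"
          using q(2) \<rho>(1) by linarith
        then have "norm (z ?i) ^ Suc n < (e / 2) ^ Suc n"
          using \<rho>(2) root[of z] z VX[OF V(1)] by (metis norm_power order_less_le_trans subsetD)
        then show ?thesis
          by (rule power_less_imp_less_base) (use e in auto)
      qed
      then show ?thesis
        using xy norm_triangle_ineq4[of "x ?i" "y ?i"] unfolding dist_norm
        by (smt (verit) field_sum_of_halves)
    next
      case False
      let ?s = "s V q"
      have "norm (?s ^ Suc n) \<le> 1"
        unfolding s_root[OF V(1) False V(2)] f_def by (rule norm_rhs_le)
      then have s1: "norm ?s \<le> 1"
        unfolding norm_power by (metis norm_ge_zero not_le one_less_power zero_less_Suc)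
      have "dist (z ?i) ?s < e / 2" if z: "z \<in> W" for z
      proof -
        have zV: "z \<in> V" "s V z = ?s"
          using z V(3) False by (auto simp: piece_def)
        then have "z ?i - ?s = ?s * (rt n (f z / f (p V)) - 1)"
          unfolding zV(2)[symmetric] by (simp add: s_def right_diff_distrib)
        then have "dist (z ?i) ?s = norm ?s * norm (rt n (f z / f (p V)) - 1)"
          by (simp add: dist_norm norm_mult)
        also have "\<dots> \<le> norm (rt n (f z / f (p V)) - 1)"
          using s1 by (simp add: mult_left_le_one_le)
        also have "\<dots> < e / 2"
          using high[OF V(1) False zV(1)] d(2) by blast
        finally show ?thesis .
      qed
      then show ?thesis
        using W(2,3) dist_triangle_half_l by blast
    qed
    then show ?thesis
      using clV[OF V(1) xy(1,2)] by (auto simp: close_def)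
  qed
  ultimately have "fine_cover m (insert ?i A) e ?W"
    unfolding fine_cover_def finite_open_cover_def by auto
  then show ?thesis ..
qed

text \<open>The vertices of the Freudenthal triangulation whose open stars contain \<open>t\<close> form a chain.\<close>

lemma card_freudenthal_le:
  fixes t :: "nat \<Rightarrow> real" and u :: "'v \<Rightarrow> nat \<Rightarrow> int"
  assumes inj: "\<And>v w. v \<in> N \<Longrightarrow> w \<in> N \<Longrightarrow> (\<And>j. j < m \<Longrightarrow> u v j = u w j) \<Longrightarrow> v = w"
    and near: "\<And>v j. v \<in> N \<Longrightarrow> j < m \<Longrightarrow> \<bar>t j - u v j\<bar> < 1"
    and star: "\<And>v j k. v \<in> N \<Longrightarrow> j < m \<Longrightarrow> k < m \<Longrightarrow> (t j - u v j) - (t k - u v k) < 1"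
  shows "card N \<le> m + 1"
proof -
  \<comment> \<open>The level of a vertex above the floor of \<open>t\<close>; it has
    \<open>m + 1\<close> possible values and is injective on a chain.\<close>
  define S where "S v = (\<Sum>j<m. u v j - \<lfloor>t j\<rfloor>)" for v
  have u01: "u v j - \<lfloor>t j\<rfloor> \<in> {0..1}" if "v \<in> N" "j < m" for v j
    using near[OF that] by (simp add: abs_less_iff) linarith
  have "S v \<in> {0..int m}" if "v \<in> N" for v
  proof -
    have "S v \<ge> 0"
      unfolding S_def using u01 that by (intro sum_nonneg) auto
    moreover have "S v \<le> (\<Sum>j<m. 1)"
      unfolding S_def using u01 that by (intro sum_mono) auto
    ultimately show ?thesis
      by simp
  qed
  moreover have "inj_on S N"
  proof (rule inj_onI)
    fix v w assume vw: "v \<in> N" "w \<in> N" "S v = S w"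
    \<comment> \<open>If \<open>v\<close> and \<open>w\<close> were incomparable, the two star
      inequalities, one for each, would add up to a bound below 2 on two integer jumps of at least 1
      each.\<close>
    have chain: "\<not> (u v j < u w j \<and> u w k < u v k)" if "j < m" "k < m" for j k
    proof
      assume *: "u v j < u w j \<and> u w k < u v k"
      then have "real_of_int (u w j) \<ge> u v j + 1" "real_of_int (u v k) \<ge> u w k + 1"
        by linarith+
      then show False
        using star[OF vw(1) that] star[OF vw(2) that(2,1)] by linarith
    qed
    have sum0: "(\<Sum>j<m. u v j - u w j) = 0"
      using vw(3) by (simp add: S_def sum_subtractf)
    show "v = w"
    proof (rule inj[OF vw(1,2)])
      fix j assume j: "j < m"
      consider "\<forall>j<m. u v j \<ge> u w j" | "\<forall>j<m. u v j \<le> u w j"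
        using chain by (meson linorder_not_less)
      then show "u v j = u w j"
      proof cases
        case 1
        then have "\<forall>j\<in>{..<m}. u v j - u w j = 0"
          using sum0 sum_nonneg_eq_0_iff[of "{..<m}" "\<lambda>j. u v j - u w j"] by simp
        then show ?thesis
          using j by auto
      next
        case 2
        then have "\<forall>j\<in>{..<m}. u w j - u v j = 0"
          using sum0 sum_nonneg_eq_0_iff[of "{..<m}" "\<lambda>j. u w j - u v j"]
          by (simp add: sum_subtractf)
        then show ?thesis
          using j by auto
      qed
    qed
  qed
  ultimately have "card N \<le> card {0..int m}"
    by (intro card_inj_on_le[of S]) auto
  then show ?thesis
    by simp
qed

section \<open>Angles and a triangulation of the torus\<close>

definition angle :: "complex \<Rightarrow> complex \<Rightarrow> real" where
  "angle z w = Im (Ln (w / z))"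

lemma cis_angle:
  assumes "norm z = 1" "norm w = 1"
  shows "w = z * cis (angle z w)"
proof -
  have "z \<noteq> 0" "w \<noteq> 0"
    using assms by auto
  then have "w / z = exp (Ln (w / z))"
    by simp
  also have "Re (Ln (w / z)) = 0"
    using assms \<open>z \<noteq> 0\<close> \<open>w \<noteq> 0\<close> by (simp add: norm_divide)
  then have "exp (Ln (w / z)) = cis (angle z w)"
    by (simp add: angle_def exp_eq_polar)
  finally show ?thesis
    using \<open>z \<noteq> 0\<close> by (simp add: field_simps)
qed

lemma Ln_cis: "-pi < t \<Longrightarrow> t \<le> pi \<Longrightarrow> Ln (cis t) = \<i> * of_real t"
  by (simp add: cis_conv_exp)

lemma angle_mult_cis:
  assumes "z \<noteq> 0" "-pi < t" "t \<le> pi"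
  shows "angle z (z * cis t) = t"
  using assms by (simp add: angle_def Ln_cis)

text \<open>The members are the open stars of the Freudenthal triangulation of the torus with
  \<open>M\<close> vertices on each circle.\<close>

lemma fine_cover_torus:
  assumes "A \<subseteq> range Base" "e > 0"
  shows "\<exists>\<V>. fine_cover m A e \<V>"
proof -
  let ?X = "tower m"
  \<comment> \<open>\<open>M \<ge> 5\<close> gives \<open>\<theta> < pi / 2\<close>; the other bound
    gives \<open>2 * \<theta> < e\<close>, as a star has width up to \<open>2 * \<theta>\<close> in
    each coordinate.\<close>
  obtain M :: nat where "max 5 (4 * pi / e) < M"
    using reals_Archimedean2 by blast
  then have M: "M \<ge> 5" "4 * pi / e < M"
    by auto
  define \<theta> where "\<theta> = 2 * pi / M"
  have \<theta>: "\<theta> > 0" "\<theta> < pi / 2" "2 * \<theta> < e" "M * \<theta> = 2 * pi"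
    using M assms(2) by (auto simp: \<theta>_def field_simps intro: order_less_le_trans[of _ "5 * pi"])
  let ?N = "PiE {..<m} (\<lambda>_. {..<M})"
  define d where "d v x j = angle (cis (\<theta> * real (v j))) (x (Base j)) / \<theta>" for v x and j :: nat
  \<comment> \<open>\<open>d v x\<close> are the coordinates of \<open>x\<close> relative to the
    vertex \<open>v\<close>. The positive real part keeps the quotient off the branch cut of the
    logarithm, so that they are continuous; the inequalities describe the open star.\<close>
  define cell where "cell v = {x\<in>?X. (\<forall>j<m. Re (x (Base j) / cis (\<theta> * real (v j))) > 0 \<and> \<bar>d v x j\<bar> < 1 \<and>
      (\<forall>k<m. d v x j - d v x k < 1))}" for v
  have d: "x (Base j) = cis (\<theta> * (v j + d v x j))" if "x \<in> ?X" "j < m" for x v j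
    using cis_angle[of "cis (\<theta> * real (v j))" "x (Base j)"] tower_Base[OF that(1), of j] that(2) \<theta>(1)
    by (simp add: d_def cis_mult distrib_left)
  have "finite ?N"
    by (intro finite_PiE) auto
  then have "finite (cell ` ?N)"
    by simp
  moreover have "openin (top_of_set ?X) (cell v)" for v
  proof -
    define H where "H = {x\<in>?X. \<forall>j<m. Re (x (Base j) / cis (\<theta> * real (v j))) > 0}"
    have contB: "continuous_on S (\<lambda>x::idx \<Rightarrow> complex. x (Base j))" for S j
      by (rule continuous_on_subset[OF continuous_on_product_coordinates]) auto
    have H: "openin (top_of_set ?X) H"
    proof -
      have "open {x. Re (x (Base j) / cis (\<theta> * real (v j))) > 0}" for j
        by (intro open_Collect_less continuous_intros contB) auto
      then have "open (\<Inter>j<m. {x. Re (x (Base j) / cis (\<theta> * real (v j))) > 0})"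
        by auto
      moreover have "H = ?X \<inter> (\<Inter>j<m. {x. Re (x (Base j) / cis (\<theta> * real (v j))) > 0})"
        by (auto simp: H_def)
      ultimately show ?thesis
        by (simp add: openin_open_Int)
    qed
    have contd: "continuous_on H (\<lambda>x. d v x j)" if "j < m" for j
      unfolding d_def angle_def using that \<theta>(1)
      by (intro continuous_intros contB) (auto simp: H_def dest: Re_pos_notin_nonpos)
    have "openin (top_of_set H) ((\<Inter>j\<in>{..<m}. H \<inter> (\<lambda>x. d v x j) -` {-1<..<1}) \<inter> topspace (top_of_set H))"
      by (intro openin_INT continuous_openin_preimage_gen contd) auto
    moreover have "openin (top_of_set H) ((\<Inter>q\<in>{..<m} \<times> {..<m}. H \<inter> (\<lambda>x. d v x (fst q) - d v x (snd q)) -` {..<1}) \<inter>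
        topspace (top_of_set H))"
      by (intro openin_INT continuous_openin_preimage_gen continuous_on_diff contd) auto
    ultimately have "openin (top_of_set H) (((\<Inter>j\<in>{..<m}. H \<inter> (\<lambda>x. d v x j) -` {-1<..<1}) \<inter> topspace (top_of_set H)) \<inter>
        ((\<Inter>q\<in>{..<m} \<times> {..<m}. H \<inter> (\<lambda>x. d v x (fst q) - d v x (snd q)) -` {..<1}) \<inter>
        topspace (top_of_set H)))" (is "openin _ ?C")
      by (rule openin_Int)
    moreover have "?C = cell v"
      by (auto simp: cell_def H_def abs_less_iff)
    ultimately show ?thesis
      using openin_trans H by metis
  qed
  moreover have "\<Union>(cell ` ?N) = ?X"
  proof
    show "?X \<subseteq> \<Union>(cell ` ?N)"
    proof
      fix x assume x: "x \<in> ?X"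
      define t where "t j = Arg2pi (x (Base j)) / \<theta>" for j
      have t: "x (Base j) = cis (\<theta> * t j)" "0 \<le> t j" "t j < M" if "j < m" for j
        using Arg2pi[of "x (Base j)"] tower_Base[OF x, of j] that \<theta>
        by (auto simp: t_def is_Arg_def cis_conv_exp field_simps)
      \<comment> \<open>Rounding down leaves all offsets in [0, 1), so their differences are below 1
        and \<open>x\<close> lies in the star of \<open>v\<close>.\<close>
      define v where "v = restrict (\<lambda>j. nat \<lfloor>t j\<rfloor>) {..<m}"
      have v: "real (v j) \<le> t j" "t j - v j < 1" "v j < M" if "j < m" for j
        using t(2,3)[OF that] that by (auto simp: v_def) linarith+
      have dv: "d v x j = t j - v j \<and> Re (x (Base j) / cis (\<theta> * real (v j))) > 0" if "j < m" for j
      proof -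
        have b: "0 \<le> \<theta> * (t j - v j)" "\<theta> * (t j - v j) < \<theta>"
          using v[OF that] \<theta>(1) by auto
        have x': "x (Base j) = cis (\<theta> * real (v j)) * cis (\<theta> * (t j - v j))"
          using t(1)[OF that] by (simp add: cis_mult right_diff_distrib)
        have "angle (cis (\<theta> * real (v j))) (x (Base j)) = \<theta> * (t j - v j)"
          unfolding x' by (rule angle_mult_cis) (use b \<theta>(2) in auto)
        moreover have "Re (x (Base j) / cis (\<theta> * real (v j))) = cos (\<theta> * (t j - v j))"
          unfolding x' by simp
        moreover have "cos (\<theta> * (t j - v j)) > 0"
          using b \<theta>(2) by (intro cos_gt_zero_pi) auto
        ultimately show ?thesis
          using \<theta>(1) by (simp add: d_def)
      qed
      have "x \<in> cell v"
        unfolding cell_def using x dv v by (auto simp: abs_less_iff) (smt (verit))+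
      moreover have "v \<in> ?N"
        using v(3) by (auto simp: v_def)
      ultimately show "x \<in> \<Union>(cell ` ?N)"
        by blast
    qed
  qed (auto simp: cell_def)
  moreover have "close A e x y" if xy: "x \<in> cell v" "y \<in> cell v" for v x y
    unfolding close_def
  proof
    fix i assume "i \<in> A"
    then obtain j where j: "i = Base j"
      using assms(1) by auto
    have X: "x \<in> ?X" "y \<in> ?X"
      using xy by (auto simp: cell_def)
    show "dist (x i) (y i) < e"
    proof (cases "j < m")
      case True
      have "dist (x i) (y i) \<le> \<bar>\<theta> * (v j + d v x j) - \<theta> * (v j + d v y j)\<bar>"
        unfolding j d[OF X(1) True, of v] d[OF X(2) True, of v] dist_norm by (rule norm_cis_diff_le)
      also have "\<dots> = \<theta> * \<bar>d v x j - d v y j\<bar>"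
        using \<theta>(1) by (simp add: abs_mult flip: right_diff_distrib)
      also have "\<dots> \<le> \<theta> * 2"
        using \<theta>(1) xy True by (intro mult_left_mono) (fastforce simp: cell_def)+
      finally show ?thesis
        using \<theta>(3) by simp
    next
      case False
      then have "x i = 0" "y i = 0"
        using tower_Base[OF X(1), of j] tower_Base[OF X(2), of j] by (simp_all add: j)
      then show ?thesis
        using assms(2) by simp
    qed
  qed
  moreover have "card {W\<in>cell ` ?N. x \<in> W} \<le> m + 1" if x: "x \<in> ?X" for x
  proof -
    define t where "t j = Arg2pi (x (Base j)) / \<theta>" for j
    have t: "x (Base j) = cis (\<theta> * t j)" if "j < m" for j
      using Arg2pi[of "x (Base j)"] tower_Base[OF x, of j] that \<theta>
      by (auto simp: t_def is_Arg_def cis_conv_exp field_simps)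
    \<comment> \<open>The lift of a vertex, given mod \<open>M\<close>, to the integer point at
      offset \<open>d v x\<close> from \<open>t\<close>; distinct vertices have distinct lifts, so
      the count in Euclidean space applies.\<close>
    define u where "u v j = \<lfloor>t j - d v x j\<rfloor>" for v j
    have u: "t j - u v j = d v x j" "u v j mod M = int (v j) mod M" if "j < m" for v j
    proof -
      have "cis (\<theta> * t j) = cis (\<theta> * (v j + d v x j))"
        using t[OF that] d[OF x that] by simp
      then obtain k :: int where "\<theta> * t j = \<theta> * (v j + d v x j) + k * (2 * pi)"
        unfolding cis_conv_exp exp_eq by (auto simp: complex_eq_iff)
      then have "\<theta> * t j = \<theta> * (v j + d v x j + k * M)"
        using \<theta>(4) by (simp add: algebra_simps)
      then have "t j - d v x j = of_int (int (v j) + k * int M)"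
        using \<theta>(1) by simp
      then have "u v j = int (v j) + k * int M" "t j - u v j = d v x j"
        unfolding u_def by (metis floor_of_int, metis add_diff_cancel_left' diff_add_cancel floor_of_int)
      then show "t j - u v j = d v x j" "u v j mod M = int (v j) mod M"
        by simp_all
    qed
    let ?S = "{v\<in>?N. x \<in> cell v}"
    have "card ?S \<le> m + 1"
    proof (rule card_freudenthal_le[where t = t and u = u])
      fix v w assume vw: "v \<in> ?S" "w \<in> ?S" "\<And>j. j < m \<Longrightarrow> u v j = u w j"
      have "v j = w j" if "j < m" for j
      proof -
        have "v j < M" "w j < M"
          using vw(1,2) that by auto
        then show ?thesis
          using u(2)[OF that, of v] u(2)[OF that, of w] vw(3)[OF that] by simp
      qed
      then show "v = w"
        using vw(1,2) by (auto intro: PiE_ext)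
    qed (auto simp: u cell_def)
    moreover have "{W\<in>cell ` ?N. x \<in> W} = cell ` ?S"
      by auto
    moreover have "card (cell ` ?S) \<le> card ?S"
      using \<open>finite ?N\<close> by (intro card_image_le) auto
    ultimately show ?thesis
      by simp
  qed
  ultimately have "fine_cover m A e (cell ` ?N)"
    unfolding fine_cover_def finite_open_cover_def by auto
  then show ?thesis ..
qed

lemma fine_cover_exists:
  assumes "finite A" "e > 0"
  shows "\<exists>\<V>. fine_cover m A e \<V>"
  using assms
proof (induction A arbitrary: e rule: finite_sub_induct)
  case (Base A)
  then show ?case
    by (simp add: fine_cover_torus)
next
  case (Root A n \<iota> \<phi>)
  obtain d where d: "d > 0" "d \<le> 1 / 2" "\<And>w. norm (w - 1) < d \<Longrightarrow> norm (rt n w - 1) < e / 2"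
    using rt_near_1[of "e / 2" n] Root(5) by auto
  define \<rho> where "\<rho> = (e / 2) ^ Suc n / 2"
  have \<rho>: "\<rho> > 0" "2 * \<rho> \<le> (e / 2) ^ Suc n"
    using Root(5) by (simp_all add: \<rho>_def)
  obtain B eB where B: "finite B" "B \<subseteq> range \<iota>" "eB > 0"
    "\<And>x y. x \<in> tower m \<Longrightarrow> y \<in> tower m \<Longrightarrow> close B eB x y \<Longrightarrow>
      dist (rhs \<iota> \<phi> x) (rhs \<iota> \<phi> y) < d * \<rho>"
    using uniform_close_continuous[OF compact_tower continuous_on_rhs, of "range \<iota>" \<iota> \<phi> "d * \<rho>" m]
      d(1) \<rho>(1) by (metis mult_pos_pos rangeI rhs_cong)
  obtain \<V> where "fine_cover m (A - {Root n \<iota> \<phi>} \<union> B) (min e eB) \<V>"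
    using Root(4)[OF B(1,2), of "min e eB"] Root(5) B(3) by auto
  then have "\<exists>\<W>. fine_cover m (insert (Root n \<iota> \<phi>) (A - {Root n \<iota> \<phi>})) e \<W>"
    using d(2,3) \<rho> B(4) Root(5) by (intro fine_cover_root)
  then show ?case
    using Root(2) by (simp add: insert_absorb)
qed

lemma tower_nonempty: "tower m \<noteq> {}"
  using tower_over_torus[of "\<lambda>j. if j < m then 1 else 0" m] by fastforce

lemma covering_dim_le_tower: "covering_dim_le (top_of_set (tower m)) (int m)"
  unfolding covering_dim_le_def
proof (intro allI impI)
  fix \<U> assume U: "finite_open_cover (top_of_set (tower m)) \<U>"
  obtain A e where Ae: "finite A" "e > 0"
      "\<And>x. x \<in> tower m \<Longrightarrow> \<exists>U\<in>\<U>. \<forall>y\<in>tower m. close A e x y \<longrightarrow> y \<in> U"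
    using lebesgue_close[OF compact_tower U] by blast
  obtain \<V> where V: "fine_cover m A e \<V>"
    using fine_cover_exists[OF Ae(1,2)] by blast
  have "\<exists>U\<in>\<U>. V \<subseteq> U" if "V \<in> \<V>" for V
  \<comment> \<open>An empty member needs a container as well, which exists since the tower is not
    empty.\<close>
  proof (cases "V = {}")
    case True
    then show ?thesis
      using Ae(3) tower_nonempty[of m] by blast
  next
    case False
    then obtain x where x: "x \<in> V"
      by blast
    have sub: "V \<subseteq> tower m"
      using V that by (auto simp: fine_cover_def finite_open_cover_def)
    moreover have "close A e x y" if "y \<in> V" for y
      using V x that \<open>V \<in> \<V>\<close> by (auto simp: fine_cover_def)
    ultimately show ?thesis
      using Ae(3)[of x] x by blast
  qed
  moreover have "int (card {V\<in>\<V>. x \<in> V}) \<le> int m + 1" if "x \<in> tower m" for x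
    using V that by (fastforce simp: fine_cover_def)
  ultimately show "\<exists>\<V>. finite_open_cover (top_of_set (tower m)) \<V> \<and> (\<forall>V\<in>\<V>. \<exists>U\<in>\<U>. V \<subseteq> U) \<and>
      (\<forall>x\<in>topspace (top_of_set (tower m)). int (card {V\<in>\<V>. x \<in> V}) \<le> int m + 1)"
    using V by (intro exI[of _ \<V>]) (auto simp: fine_cover_def)
qed

section \<open>Cochains\<close>

text \<open>A \<open>d\<close>-cochain is a function of sequences that depends on the entries with index at most \<open>d\<close> only;
  \<open>cob m\<close> is the coboundary of \<open>(m - 1)\<close>-cochains.\<close>

definition skip :: "nat \<Rightarrow> nat \<Rightarrow> nat" where
  "skip q k = (if k < q then k else Suc k)"

definition cob :: "nat \<Rightarrow> ((nat \<Rightarrow> 'p) \<Rightarrow> real) \<Rightarrow> (nat \<Rightarrow> 'p) \<Rightarrow> real" where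
  "cob m b x = (\<Sum>q\<le>m. (-1) ^ q * b (x \<circ> skip q))"

text \<open>The cocycle identity for the vertices of a single simplex only, as angles add up only
  for points close to each other.\<close>

definition additive_on :: "(nat \<Rightarrow> 'p) \<Rightarrow> nat \<Rightarrow> ('p \<Rightarrow> 'p \<Rightarrow> real) \<Rightarrow> bool" where
  "additive_on x m \<alpha> \<longleftrightarrow>
     (\<forall>i\<le>m. \<forall>j\<le>m. \<forall>k\<le>m. \<alpha> (x i) (x k) = \<alpha> (x i) (x j) + \<alpha> (x j) (x k))"

text \<open>The Alexander-Whitney cup product of 1-cochains.\<close>

fun cup :: "('p \<Rightarrow> 'p \<Rightarrow> real) list \<Rightarrow> (nat \<Rightarrow> 'p) \<Rightarrow> real" where
  "cup [] x = 1"
| "cup (\<alpha> # as) x = \<alpha> (x 0) (x 1) * cup as (x \<circ> Suc)"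

definition twist :: "('p \<Rightarrow> 'p \<Rightarrow> real) \<times> ('p \<Rightarrow> real) \<Rightarrow> 'p \<Rightarrow> 'p \<Rightarrow> real" where
  "twist r x y = fst r x y + snd r y - snd r x"

text \<open>Twisting a 1-cocycle \<open>\<alpha>\<close> by the coboundary of \<open>s\<close> changes a cup product by a coboundary, by the
  Leibniz rule.\<close>

fun cup_homotopy :: "(('p \<Rightarrow> 'p \<Rightarrow> real) \<times> ('p \<Rightarrow> real)) list \<Rightarrow> (nat \<Rightarrow> 'p) \<Rightarrow> real" where
  "cup_homotopy [] x = 0"
| "cup_homotopy (r # rs) x =
     snd r (x 0) * cup (map twist rs) x - fst r (x 0) (x 1) * cup_homotopy rs (x \<circ> Suc)"

lemma additive_onD:
  "additive_on x m \<alpha> \<Longrightarrow> i \<le> m \<Longrightarrow> j \<le> m \<Longrightarrow> k \<le> m \<Longrightarrow> \<alpha> (x i) (x k) = \<alpha> (x i) (x j) + \<alpha> (x j) (x k)"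
  unfolding additive_on_def by blast

lemma additive_on_Suc: "additive_on x (Suc m) \<alpha> \<Longrightarrow> additive_on (x \<circ> Suc) m \<alpha>"
  unfolding additive_on_def comp_def by blast

lemma additive_on_twist: "additive_on x m (fst r) \<Longrightarrow> additive_on x m (twist r)"
  unfolding additive_on_def[of _ _ "twist r"]
proof (intro allI impI)
  fix i j k
  assume "additive_on x m (fst r)" "i \<le> m" "j \<le> m" "k \<le> m"
  then have "fst r (x i) (x k) = fst r (x i) (x j) + fst r (x j) (x k)"
    by (rule additive_onD)
  then show "twist r (x i) (x k) = twist r (x i) (x j) + twist r (x j) (x k)"
    by (simp add: twist_def)
qed

lemma additive_on_sum:
  assumes "additive_on x m \<alpha>" "p \<le> q" "q \<le> m"
  shows "(\<Sum>i\<in>{p..<q}. \<alpha> (x i) (x (Suc i))) = \<alpha> (x p) (x q)"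
  using assms(2,3)
proof (induction q rule: dec_induct)
  case base
  have "\<alpha> (x p) (x p) = \<alpha> (x p) (x p) + \<alpha> (x p) (x p)"
    using assms(1) by (rule additive_onD) (use base in auto)
  then show ?case
    by simp
next
  case (step q)
  have "\<alpha> (x p) (x (Suc q)) = \<alpha> (x p) (x q) + \<alpha> (x q) (x (Suc q))"
    using assms(1) by (rule additive_onD) (use step in auto)
  then show ?case
    using step by simp
qed

lemma cob_Suc:
  "cob (Suc m) b x = b (x \<circ> Suc) - (\<Sum>q\<le>m. (-1) ^ q * b (x \<circ> skip (Suc q)))"
proof -
  have "x \<circ> skip 0 = x \<circ> Suc"
    by (auto simp: skip_def)
  then show ?thesis
    unfolding cob_def sum.atMost_Suc_shift by (simp add: sum_negf)
qed

lemma skip_Suc [simp]: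
  "(x \<circ> skip (Suc q)) 0 = x 0" "(x \<circ> skip (Suc q)) \<circ> Suc = (x \<circ> Suc) \<circ> skip q"
  by (auto simp: skip_def)

lemma cob_diff: "cob m (\<lambda>x. b x - c x) x = cob m b x - cob m c x"
  by (simp add: cob_def right_diff_distrib sum_subtractf)

lemma cob_sum: "cob m (\<lambda>x. \<Sum>i\<in>I. b i x) x = (\<Sum>i\<in>I. cob m (b i) x)"
  unfolding cob_def sum_distrib_left by (rule sum.swap)

lemma cob_cmult: "cob m (\<lambda>x. c * b x) x = c * cob m b x"
  by (simp add: cob_def sum_distrib_left mult.left_commute)

text \<open>The Leibniz rule for a 1-cocycle. Omitting vertex 1 turns
  \<open>\<alpha> (x 0) (x 1)\<close> into \<open>\<alpha> (x 0) (x 2)\<close>, and the excess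
  \<open>\<alpha> (x 1) (x 2)\<close> cancels the face omitting vertex 0. The condition
  \<open>m > 0\<close> puts vertex 2 inside the simplex.\<close>

lemma cob_cup_front:
  assumes "additive_on x (Suc m) \<alpha>" "m > 0"
  shows "cob (Suc m) (\<lambda>x. \<alpha> (x 0) (x 1) * b (x \<circ> Suc)) x = - \<alpha> (x 0) (x 1) * cob m b (x \<circ> Suc)"
proof -
  have add: "\<alpha> (x 0) (x 2) = \<alpha> (x 0) (x 1) + \<alpha> (x 1) (x 2)"
    using assms by (intro additive_onD) auto
  have *: "(-1) ^ q * (\<alpha> ((x \<circ> skip (Suc q)) 0) ((x \<circ> skip (Suc q)) 1) * b ((x \<circ> skip (Suc q)) \<circ> Suc)) =
      \<alpha> (x 0) (x 1) * ((-1) ^ q * b (x \<circ> Suc \<circ> skip q)) + (if q = 0 then \<alpha> (x 1) (x 2) * b (x \<circ> Suc \<circ> Suc) else 0)"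
    for q
  proof -
    have s1: "(x \<circ> skip (Suc q)) 1 = (if q = 0 then x 2 else x 1)"
      by (auto simp: skip_def numeral_2_eq_2)
    have s0: "x \<circ> Suc \<circ> skip 0 = x \<circ> Suc \<circ> Suc"
      by (auto simp: skip_def)
    show ?thesis
      unfolding skip_Suc s1 by (cases "q = 0") (simp_all add: s0 add distrib_right del: comp_apply)
  qed
  show ?thesis
    unfolding cob_Suc * sum.distrib
    by (simp add: cob_def sum_distrib_left[symmetric] numeral_2_eq_2)
qed

lemma cob_cup:
  assumes "\<And>\<alpha>. \<alpha> \<in> set as \<Longrightarrow> additive_on x (Suc (length as)) \<alpha>"
  shows "cob (Suc (length as)) (cup as) x = 0"
  using assms
proof (induction as arbitrary: x)
  case Nil
  show ?case
    by (simp add: cob_def)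
next
  case (Cons \<alpha> as)
  have "cob (Suc (length as)) (cup as) (x \<circ> Suc) = 0"
    using Cons.prems by (intro Cons.IH) (auto intro!: additive_on_Suc[unfolded comp_def] simp: comp_def)
  then show ?case
    using cob_cup_front[of x "Suc (length as)" \<alpha> "cup as"] Cons.prems by simp
qed

text \<open>The Leibniz rule for a 0-cochain: only the face omitting vertex 0 sees another value of
  \<open>s\<close>.\<close>

lemma cob_scale_front:
  "cob (Suc m) (\<lambda>x. s (x 0) * b x) x = (s (x 1) - s (x 0)) * b (x \<circ> Suc) + s (x 0) * cob (Suc m) b x"
proof -
  have "(\<Sum>q\<le>m. (-1) ^ q * (s ((x \<circ> skip (Suc q)) 0) * b (x \<circ> skip (Suc q)))) =
      s (x 0) * (\<Sum>q\<le>m. (-1) ^ q * b (x \<circ> skip (Suc q)))"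
    by (simp add: sum_distrib_left mult.left_commute del: comp_apply)
  then show ?thesis
    unfolding cob_Suc by (simp add: algebra_simps)
qed

text \<open>By the Leibniz rules the first term of the homotopy twists the first factor, with the
  others already twisted, and the second term twists the others by induction. The twisted product of
  the rest is a cocycle, which removes the remaining term.\<close>

lemma cob_cup_homotopy:
  assumes "\<And>r. r \<in> set rs \<Longrightarrow> additive_on x (length rs) (fst r)"
  shows "cob (length rs) (cup_homotopy rs) x = cup (map twist rs) x - cup (map fst rs) x"
  using assms
proof (induction rs arbitrary: x)
  case Nil
  show ?case
    by (simp add: cob_def)
next
  case step: (Cons r rs)
  have IH: "cob (length rs) (cup_homotopy rs) (x \<circ> Suc) =
      cup (map twist rs) (x \<circ> Suc) - cup (map fst rs) (x \<circ> Suc)"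
    using step.prems by (intro step.IH) (auto intro!: additive_on_Suc[unfolded comp_def] simp: comp_def)
  have cup0: "cob (Suc (length rs)) (cup (map twist rs)) x = 0"
  proof -
    have "additive_on x (Suc (length rs)) \<alpha>" if \<alpha>: "\<alpha> \<in> set (map twist rs)" for \<alpha>
    proof -
      obtain r where "r \<in> set rs" "\<alpha> = twist r"
        using \<alpha> unfolding set_map by blast
      then show ?thesis
        using step.prems[of r] by (simp add: additive_on_twist)
    qed
    then show ?thesis
      using cob_cup[of "map twist rs" x] by simp
  qed
  have front: "cob (Suc (length rs)) (\<lambda>x. fst r (x 0) (x 1) * cup_homotopy rs (x \<circ> Suc)) x =
      - fst r (x 0) (x 1) * cob (length rs) (cup_homotopy rs) (x \<circ> Suc)"
  \<comment> \<open>\<open>cob_cup_front\<close> needs positive degree; for the empty list the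
    homotopy is 0.\<close>
  proof (cases rs)
    case Nil
    then show ?thesis
      by (simp add: cob_def)
  next
    case (Cons r' rs')
    then show ?thesis
      using step.prems by (intro cob_cup_front) auto
  qed
  have "cob (Suc (length rs)) (cup_homotopy (r # rs)) x =
      cob (Suc (length rs)) (\<lambda>x. snd r (x 0) * cup (map twist rs) x) x -
      cob (Suc (length rs)) (\<lambda>x. fst r (x 0) (x 1) * cup_homotopy rs (x \<circ> Suc)) x"
    unfolding cob_diff[symmetric] by (simp only: cob_def cup_homotopy.simps)
  also have "\<dots> = (snd r (x 1) - snd r (x 0)) * cup (map twist rs) (x \<circ> Suc) +
      fst r (x 0) (x 1) * (cup (map twist rs) (x \<circ> Suc) - cup (map fst rs) (x \<circ> Suc))"
    unfolding front IH cob_scale_front cup0 by simp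
  also have "\<dots> = cup (map twist (r # rs)) x - cup (map fst (r # rs)) x"
    by (simp add: twist_def[of r] algebra_simps)
  finally show ?case
    by (simp only: length_Cons)
qed

lemma cup_eq_prod: "cup as x = (\<Prod>i<length as. (as ! i) (x i) (x (Suc i)))"
  by (induction as arbitrary: x) (simp_all add: prod.lessThan_Suc_shift del: prod.lessThan_Suc)

lemma cup_cong:
  assumes "\<And>k. k \<le> length as \<Longrightarrow> x k = y k"
  shows "cup as x = cup as y"
  unfolding cup_eq_prod using assms by (intro prod.cong) auto

lemma cup_homotopy_cong:
  assumes "\<And>k. k < length rs \<Longrightarrow> x k = y k"
  shows "cup_homotopy rs x = cup_homotopy rs y"
  using assms
proof (induction rs arbitrary: x y)
  case (Cons r rs)
  have "cup (map twist rs) x = cup (map twist rs) y"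
    using Cons.prems by (intro cup_cong) auto
  moreover have "cup_homotopy rs (x \<circ> Suc) = cup_homotopy rs (y \<circ> Suc)"
    using Cons.prems by (intro Cons.IH) auto
  \<comment> \<open>For empty \<open>rs\<close> the vertex \<open>x 1\<close> is out of range, but
    its factor is multiplied by 0. So the homotopy has degree one less than the product.\<close>
  moreover have "x 1 = y 1" if "rs \<noteq> []"
    using that Cons.prems[of 1] by (cases rs) auto
  ultimately show ?case
    using Cons.prems[of 0] by (cases "rs = []") auto
qed simp

text \<open>The determinant of the increments \<open>a j (x i) (x (Suc i))\<close>, in the Leibniz
  expansion, so that results on \<open>cup\<close> apply term by term.\<close>

definition alt_cup :: "nat \<Rightarrow> (nat \<Rightarrow> 'p \<Rightarrow> 'p \<Rightarrow> real) \<Rightarrow> (nat \<Rightarrow> 'p) \<Rightarrow> real" where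
  "alt_cup m a x =
     (\<Sum>p\<in>{p. p permutes {0..<m}}. of_int (sign p) * cup (map (\<lambda>i. a (p i)) [0..<m]) x)"

lemma alt_cup_eq:
  "alt_cup m a x =
     (\<Sum>p\<in>{p. p permutes {0..<m}}. of_int (sign p) * (\<Prod>i = 0..<m. a (p i) (x i) (x (Suc i))))"
  unfolding alt_cup_def cup_eq_prod
  by (intro sum.cong arg_cong2[where f = "(*)"] prod.cong refl) auto

lemma alt_cup_cong:
  assumes "\<And>j k. j < m \<Longrightarrow> k < m \<Longrightarrow> a j (x k) (x (Suc k)) = b j (y k) (y (Suc k))"
  shows "alt_cup m a x = alt_cup m b y"
  unfolding alt_cup_eq
  by (intro sum.cong arg_cong2[where f = "(*)"] prod.cong refl assms)
    (auto dest: permutes_in_image)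

text \<open>By additivity the rows \<open>p\<close> up to \<open>q - 1\<close> of the matrix add up
  to the increments from \<open>x p\<close> to \<open>x q\<close>, which are 0, so the rows are
  dependent.\<close>

lemma alt_cup_degenerate:
  assumes add: "\<And>j. j < m \<Longrightarrow> additive_on x m (a j)"
    and pq: "p < q" "q \<le> m" and zero: "\<And>j. j < m \<Longrightarrow> a j (x p) (x q) = 0"
  shows "alt_cup m a x = 0"
proof -
  define A where "A = mat m m (\<lambda>(i, j). a j (x i) (x (Suc i)))"
  define v :: "real vec" where "v = vec m (\<lambda>i. if i \<in> {p..<q} then 1 else 0)"
  have A: "A \<in> carrier_mat m m"
    by (simp add: A_def)
  have "alt_cup m a x = det A"
    unfolding alt_cup_eq det_def'[OF A]
    by (intro sum.cong arg_cong2[where f = "(*)"] prod.cong refl)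
      (auto simp: A_def dest: permutes_in_image)
  moreover have "det (transpose_mat A) = 0"
  proof -
    have "transpose_mat A *\<^sub>v v = 0\<^sub>v m"
    proof (rule eq_vecI)
      fix j assume "j < dim_vec (0\<^sub>v m)"
      then have j: "j < m"
        by simp
      have "(transpose_mat A *\<^sub>v v) $ j = (\<Sum>i = 0..<m. a j (x i) (x (Suc i)) * (if i \<in> {p..<q} then 1 else 0))"
        using j by (auto simp: A_def v_def scalar_prod_def intro!: sum.cong)
      also have "\<dots> = (\<Sum>i\<in>{p..<q}. a j (x i) (x (Suc i)))"
        using pq by (intro sum.mono_neutral_cong_right) auto
      also have "\<dots> = 0"
        using additive_on_sum[OF add[OF j], of p q] pq zero[OF j] by simp
      finally show "(transpose_mat A *\<^sub>v v) $ j = 0\<^sub>v m $ j"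
        using j by simp
    qed (simp add: A_def)
    moreover have "v \<noteq> 0\<^sub>v m"
    proof
      assume "v = 0\<^sub>v m"
      then have "v $ p = 0\<^sub>v m $ p"
        by simp
      then show False
        using pq by (simp add: v_def)
    qed
    moreover have "transpose_mat A \<in> carrier_mat m m" "v \<in> carrier_vec m"
      using A by (simp_all add: v_def)
    ultimately show ?thesis
      using det_0_iff_vec_prod_zero_field by blast
  qed
  ultimately show ?thesis
    using det_transpose[OF A] by simp
qed

lemma alt_cup_twist:
  obtains b where "\<forall>x y. (\<forall>k<m. x k = y k) \<longrightarrow> b x = b y"
    "\<forall>x. (\<forall>j<m. additive_on x m (a j)) \<longrightarrow>
      cob m b x = alt_cup m (\<lambda>j. twist (a j, s j)) x - alt_cup m a x"
proof -
  define rs where "rs p = map (\<lambda>i. (a (p i), s (p i))) [0..<m]" for p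
  define b where "b x = (\<Sum>p\<in>{p. p permutes {0..<m}}. of_int (sign p) * cup_homotopy (rs p) x)" for x
  show ?thesis
  proof (rule that; intro allI impI)
    show "b x = b y" if "\<forall>k<m. x k = y k" for x y
      unfolding b_def using that
      by (intro sum.cong arg_cong2[where f = "(*)"] refl cup_homotopy_cong) (auto simp: rs_def)
    show "cob m b x = alt_cup m (\<lambda>j. twist (a j, s j)) x - alt_cup m a x"
      if add: "\<forall>j<m. additive_on x m (a j)" for x
    proof -
      have "cob m (cup_homotopy (rs p)) x = cup (map twist (rs p)) x - cup (map fst (rs p)) x"
        if "p permutes {0..<m}" for p
      proof -
        have "additive_on x m (fst r)" if r: "r \<in> set (rs p)" for r
        proof -
          obtain i where "i < m" "r = (a (p i), s (p i))"
            using r by (auto simp: rs_def)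
          then show ?thesis
            using add permutes_in_image[OF \<open>p permutes {0..<m}\<close>, of i] by simp
        qed
        then show ?thesis
          using cob_cup_homotopy[of "rs p" x] by (simp add: rs_def)
      qed
      then have "cob m b x = (\<Sum>p\<in>{p. p permutes {0..<m}}.
          of_int (sign p) * (cup (map twist (rs p)) x - cup (map fst (rs p)) x))"
        unfolding b_def[abs_def] cob_sum cob_cmult by (intro sum.cong) auto
      then show ?thesis
        by (simp add: alt_cup_def rs_def right_diff_distrib sum_subtractf comp_def)
    qed
  qed
qed

section \<open>The fundamental cycle of the torus\<close>

text \<open>A cyclic shift, built from adjacent transpositions to have its sign at hand.\<close>

primrec rot :: "nat \<Rightarrow> nat \<Rightarrow> nat" where
  "rot 0 = id"
| "rot (Suc k) = rot k \<circ> Transposition.transpose k (Suc k)"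

lemma rot_apply: "rot k i = (if i < k then Suc i else if i = k then 0 else i)"
  by (induction k arbitrary: i) (auto simp: Transposition.transpose_def)

lemma rot_permutes: "rot k permutes {0..<Suc k}"
proof (induction k)
  case (Suc k)
  have "rot k permutes {0..<Suc (Suc k)}"
    using Suc by (rule permutes_subset) auto
  then show ?case
    unfolding rot.simps by (intro permutes_compose permutes_swap_id) auto
qed (simp only: rot.simps permutes_id)

lemma permutation_of_permutes: "p permutes {0..<m::nat} \<Longrightarrow> permutation p"
  unfolding permutation_permutes by (intro exI[of _ "{0..<m}"]) simp

lemma sign_rot: "sign (rot k) = (-1) ^ k"
proof (induction k)
  case 0
  show ?case
    by (simp only: rot.simps sign_id power_0)
next
  case (Suc k)
  have "sign (rot k \<circ> Transposition.transpose k (Suc k)) = sign (rot k) * sign (Transposition.transpose k (Suc k))"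
    by (intro sign_compose permutation_of_permutes[OF rot_permutes] permutation_swap_id)
  then show ?case
    by (simp only: rot.simps Suc sign_swap_id) simp
qed

lemma sum_permutations_comp:
  assumes "q permutes S"
  shows "(\<Sum>p\<in>{p. p permutes S}. f (p \<circ> q)) = (\<Sum>p\<in>{p. p permutes S}. f p)"
proof (rule sum.reindex_bij_witness[of _ "\<lambda>p. p \<circ> inv_into UNIV q" "\<lambda>p. p \<circ> q"])
  fix p assume "p \<in> {p. p permutes S}"
  then show "p \<circ> q \<in> {p. p permutes S}" "p \<circ> inv_into UNIV q \<in> {p. p permutes S}"
    using assms by (auto intro: permutes_compose permutes_inv)
  show "(p \<circ> q) \<circ> inv_into UNIV q = p" "(p \<circ> inv_into UNIV q) \<circ> q = p"
    by (simp_all only: comp_assoc permutes_inv_o[OF assms] comp_id)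
qed simp

text \<open>The vertices of a Freudenthal simplex: from \<open>v\<close> on, the coordinates are
  raised by 1 in the order \<open>p 0\<close>, \<open>p 1\<close>, and so on. They are not reduced
  mod \<open>M\<close>; periodicity of the vertex map takes care of that.\<close>

definition path :: "(nat \<Rightarrow> nat) \<Rightarrow> (nat \<Rightarrow> nat) \<Rightarrow> nat \<Rightarrow> nat \<Rightarrow> nat" where
  "path v p k j = v j + (if j \<in> p ` {..<k} then 1 else 0)"

lemma path_Suc:
  assumes "p permutes {0..<m}"
  shows "path v p (Suc k) = (path v p k)(p k := path v p k (p k) + 1)"
proof -
  have "p k \<notin> p ` {..<k}"
    using permutes_inj[OF assms] by (auto simp: inj_eq)
  then show ?thesis
    by (auto simp: path_def lessThan_Suc fun_eq_iff)
qed

lemma sum_torus_shift: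
  fixes F :: "(nat \<Rightarrow> nat) \<Rightarrow> real"
  assumes F: "\<And>v w. (\<And>j. j < m \<Longrightarrow> v j mod M = w j mod M) \<Longrightarrow> F v = F w"
    and c: "c < m" and M: "M > 0"
  shows "(\<Sum>v\<in>PiE {..<m} (\<lambda>_. {..<M}). F (v(c := v c + 1))) = (\<Sum>v\<in>PiE {..<m} (\<lambda>_. {..<M}). F v)"
\<comment> \<open>Adding \<open>M - 1\<close> is the inverse of adding 1 mod
  \<open>M\<close>.\<close>
proof (rule sum.reindex_bij_witness[of _ "\<lambda>v. v(c := (v c + (M - 1)) mod M)" "\<lambda>v. v(c := (v c + 1) mod M)"])
  fix v assume v: "v \<in> PiE {..<m} (\<lambda>_. {..<M})"
  then have vc: "v c < M"
    using c by auto
  have in_N: "v(c := t mod M) \<in> PiE {..<m} (\<lambda>_. {..<M})" for t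
    using v c M by (auto simp: PiE_iff extensional_def)
  show "v(c := (v c + 1) mod M) \<in> PiE {..<m} (\<lambda>_. {..<M})"
       "v(c := (v c + (M - 1)) mod M) \<in> PiE {..<m} (\<lambda>_. {..<M})"
    by (rule in_N)+
  have "v c + 1 + (M - 1) = v c + M" "v c + (M - 1) + 1 = v c + M"
    using M by simp_all
  then have "((v c + 1) mod M + (M - 1)) mod M = v c" "((v c + (M - 1)) mod M + 1) mod M = v c"
    unfolding mod_add_left_eq using vc by simp_all
  then show "(v(c := (v c + 1) mod M))(c := ((v(c := (v c + 1) mod M)) c + (M - 1)) mod M) = v"
    "(v(c := (v c + (M - 1)) mod M))(c := ((v(c := (v c + (M - 1)) mod M)) c + 1) mod M) = v"
    by simp_all
  show "F (v(c := (v c + 1) mod M)) = F (v(c := v c + 1))"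
    by (rule F) auto
qed

text \<open>The simplices \<open>path v p\<close> with signs \<open>sign p\<close> form a cycle: an inner face is shared by two simplices
  that differ by an adjacent transposition, and the first face of one simplex is the last face of
  another one.\<close>

lemma alt_cup_not_coboundary:
  fixes G :: "(nat \<Rightarrow> nat) \<Rightarrow> 'p"
  assumes m: "m \<ge> 1" and M: "M > 0" and h: "h \<noteq> (0::real)"
    and per: "\<And>v w. (\<And>j. j < m \<Longrightarrow> v j mod M = w j mod M) \<Longrightarrow> G v = G w"
    and step: "\<And>v j c. j < m \<Longrightarrow> c < m \<Longrightarrow> a j (G v) (G (v(c := v c + 1))) = (if j = c then h else 0)"
    and local: "\<And>x y. (\<And>k. k < m \<Longrightarrow> x k = y k) \<Longrightarrow> b x = b y"
    and cob: "\<And>v p. p permutes {0..<m} \<Longrightarrow>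
      cob m b (\<lambda>k. G (path v p k)) = alt_cup m a (\<lambda>k. G (path v p k))"
  shows False
proof -
  let ?N = "PiE {..<m} (\<lambda>_. {..<M})" and ?P = "{p. p permutes {0..<m}}"
  define x where "x v p k = G (path v p k)" for v p k
  define \<Phi> where "\<Phi> q p = (\<Sum>v\<in>?N. b (x v p \<circ> skip q))" for q p
  define T where "T q = (\<Sum>p\<in>?P. of_int (sign p) * \<Phi> q p)" for q
  have finN: "finite ?N"
    by (intro finite_PiE) auto
  have finP: "finite ?P"
    by (simp add: finite_permutations)
  have permD: "permutation p" if "p \<in> ?P" for p
    using that permutation_of_permutes by blast
  have inner: "T q = 0" if q: "0 < q" "q < m" for q
  proof -
    let ?t = "Transposition.transpose (q - 1) q"
    have t: "?t permutes {0..<m}"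
      using q by (intro permutes_swap_id) auto
    have "\<Phi> q (p \<circ> ?t) = \<Phi> q p" for p
    proof -
      have "(p \<circ> ?t) ` {..<k} = p ` {..<k}" if "k \<noteq> q" for k
      proof -
        have "?t ` {..<k} = {..<k}"
          using q(1) that by (intro transpose_image_eq) auto
        then show ?thesis
          by (metis image_comp)
      qed
      then have "x v (p \<circ> ?t) \<circ> skip q = x v p \<circ> skip q" for v
        by (auto simp: x_def path_def skip_def fun_eq_iff intro!: arg_cong[where f = G])
      then show ?thesis
        by (simp add: \<Phi>_def)
    qed
    moreover have "sign (p \<circ> ?t) = - sign p" if "p \<in> ?P" for p
      using q(1) permD[OF that] by (simp add: sign_compose permutation_swap_id sign_swap_id)
    ultimately have "(\<Sum>p\<in>?P. of_int (sign (p \<circ> ?t)) * \<Phi> q (p \<circ> ?t)) = - T q"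
      by (simp add: T_def sum_negf)
    then show ?thesis
      using sum_permutations_comp[OF t, of "\<lambda>p. of_int (sign p) * \<Phi> q p"] by (simp add: T_def)
  qed
  obtain l where l: "m = Suc l"
    using m by (cases m) auto
  \<comment> \<open>Removing the first vertex of the simplex of \<open>v\<close> and
    \<open>p\<close> leaves the last face of the simplex that starts one step further in direction
    \<open>p 0\<close> and has the rotated order. The rotation has sign \<open>(-1) ^ l\<close> with
    \<open>l = m - 1\<close>, so the outer faces cancel.\<close>
  have outer: "T 0 = (-1) ^ l * T m"
  proof -
    have rot: "rot l permutes {0..<m}"
      using rot_permutes l by simp
    have "\<Phi> 0 p = \<Phi> m (p \<circ> rot l)" if p: "p \<in> ?P" for p
    proof -
      let ?p = "p \<circ> rot l"
      have p0: "p 0 < m"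
        using p permutes_in_image[of p "{0..<m}" 0] l by auto
      have "b (x v p \<circ> skip 0) = b (x (v(p 0 := v (p 0) + 1)) ?p \<circ> skip m)" for v
      proof (rule local)
        fix k assume k: "k < m"
        have "rot l ` {..<k} = {1..<Suc k}"
        proof -
          have "rot l ` {..<k} = Suc ` {0..<k}"
            using k l by (intro image_cong) (auto simp: rot_apply)
          then show ?thesis
            by (simp add: image_Suc_atLeastLessThan)
        qed
        then have "?p ` {..<k} = p ` {1..<Suc k}"
          by (metis image_comp)
        moreover have "p 0 \<notin> p ` {1..<Suc k}"
          using p permutes_inj[of p] by (auto simp: inj_eq)
        moreover have "{..<Suc k} = insert 0 {1..<Suc k}"
          by auto
        ultimately have "path v p (Suc k) = path (v(p 0 := v (p 0) + 1)) ?p k"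
          by (auto simp: path_def fun_eq_iff)
        then show "(x v p \<circ> skip 0) k = (x (v(p 0 := v (p 0) + 1)) ?p \<circ> skip m) k"
          using k by (simp add: x_def skip_def)
      qed
      then have "\<Phi> 0 p = (\<Sum>v\<in>?N. b (x (v(p 0 := v (p 0) + 1)) ?p \<circ> skip m))"
        by (simp add: \<Phi>_def)
      also have "\<dots> = \<Phi> m ?p"
        unfolding \<Phi>_def
      proof (rule sum_torus_shift[OF _ p0 M])
        fix v w assume vw: "\<And>j. j < m \<Longrightarrow> v j mod M = w j mod M"
        have "x v ?p = x w ?p"
          unfolding x_def path_def using vw by (intro ext per mod_add_cong refl)
        then show "b (x v ?p \<circ> skip m) = b (x w ?p \<circ> skip m)"
          by simp
      qed
      finally show ?thesis .
    qed
    moreover have "of_int (sign p) = (-1) ^ l * (of_int (sign (p \<circ> rot l)) :: real)" if "p \<in> ?P" for p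
      using permD[OF that] permutation_of_permutes[OF rot]
      by (simp add: sign_compose sign_rot flip: power_add mult_2)
    ultimately have "T 0 = (\<Sum>p\<in>?P. (-1) ^ l * (of_int (sign (p \<circ> rot l)) * \<Phi> m (p \<circ> rot l)))"
      unfolding T_def by (intro sum.cong) auto
    also have "\<dots> = (-1) ^ l * T m"
      unfolding T_def sum_distrib_left[symmetric]
      using sum_permutations_comp[OF rot, of "\<lambda>p. of_int (sign p) * \<Phi> m p"] by simp
    finally show ?thesis .
  qed
  have "(\<Sum>q\<le>m. (-1) ^ q * T q) = (\<Sum>q\<in>{0, m}. (-1) ^ q * T q)"
    using inner by (intro sum.mono_neutral_right) auto
  also have "\<dots> = 0"
    using outer l by simp
  finally have "(\<Sum>q\<le>m. (-1) ^ q * T q) = 0" .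
  moreover have "(\<Sum>q\<le>m. (-1) ^ q * T q) =
      (\<Sum>p\<in>?P. of_int (sign p) * (\<Sum>v\<in>?N. cob m b (x v p)))"
  proof -
    have "(\<Sum>q\<le>m. (-1) ^ q * T q) = (\<Sum>q\<le>m. \<Sum>p\<in>?P. \<Sum>v\<in>?N. of_int (sign p) * ((-1) ^ q * b (x v p \<circ> skip q)))"
      by (simp add: T_def \<Phi>_def sum_distrib_left mult.left_commute)
    also have "\<dots> = (\<Sum>p\<in>?P. \<Sum>v\<in>?N. \<Sum>q\<le>m. of_int (sign p) * ((-1) ^ q * b (x v p \<circ> skip q)))"
      by (subst sum.swap) (intro sum.cong refl sum.swap)
    finally show ?thesis
      by (simp add: cob_def sum_distrib_left)
  qed
  \<comment> \<open>Step \<open>i\<close> along the simplex moves only coordinate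
    \<open>p i\<close>, so only the permutation \<open>p\<close> contributes to the determinant.
    Weighted with \<open>sign p\<close>, every simplex counts \<open>h ^ m\<close> and nothing can
    cancel.\<close>
  moreover have "cob m b (x v p) = of_int (sign p) * h ^ m" if p: "p \<in> ?P" for p v
  proof -
    have perm: "p permutes {0..<m}"
      using p by simp
    have "(\<Prod>i = 0..<m. a (r i) (x v p i) (x v p (Suc i))) = (if r = p then h ^ m else 0)"
      if r: "r \<in> ?P" for r
    proof -
      have factor: "a (r i) (x v p i) (x v p (Suc i)) = (if r i = p i then h else 0)" if "i < m" for i
        unfolding x_def path_Suc[OF perm]
        using permutes_in_image[OF perm, of i] permutes_in_image[of r "{0..<m}" i] r that
        by (intro step) auto
      have eq: "(\<Prod>i = 0..<m. a (r i) (x v p i) (x v p (Suc i))) = (\<Prod>i = 0..<m. if r i = p i then h else 0)"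
        by (intro prod.cong factor) auto
      show ?thesis
      proof (cases "r = p")
        case False
        then obtain i where "r i \<noteq> p i"
          by blast
        moreover have "i < m"
          using calculation r p by (metis (no_types) atLeastLessThan_iff mem_Collect_eq permutes_not_in zero_le)
        ultimately show ?thesis
          unfolding eq using False by (auto intro!: prod_zero)
      qed (unfold eq, simp)
    qed
    then have "alt_cup m a (x v p) = (\<Sum>r\<in>?P. if r = p then of_int (sign r) * h ^ m else 0)"
      unfolding alt_cup_eq by (intro sum.cong) auto
    also have "\<dots> = of_int (sign p) * h ^ m"
      using p finP by simp
    finally show ?thesis
      using cob[OF perm, of v] by (simp add: x_def[abs_def])
  qed
  ultimately have "0 = (\<Sum>p\<in>?P. of_int (sign p) * (\<Sum>v\<in>?N. of_int (sign p) * h ^ m))"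
    by simp
  also have "\<dots> = (\<Sum>p\<in>?P. of_int (sign p * sign p) * (real (card ?N) * h ^ m))"
    by (intro sum.cong refl) (simp only: of_int_mult sum_constant mult_ac)
  also have "\<dots> = real (card ?P) * (real (card ?N) * h ^ m)"
    by simp
  also have "\<dots> \<noteq> 0"
    using h M by (simp add: card_permutations[of _ m] card_PiE)
  finally show False
    by simp
qed

section \<open>The dimension is at least m\<close>

text \<open>Distance below 1 puts both quotients in the right half-plane, where logarithms
  add.\<close>

lemma angle_add:
  assumes "norm z = 1" "norm w = 1" "norm u = 1" "dist z w < 1" "dist w u < 1"
  shows "angle z u = angle z w + angle w u"
proof -
  have Re: "Re (w / z) > 0" if "norm z = 1" "dist z w < 1" for z w :: complex
  proof -
    have "z \<noteq> 0"
      using that by auto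
    then have "w / z - 1 = (w - z) / z"
      by (simp add: diff_divide_distrib)
    then show ?thesis
      using that Re_pos_near_1[of "w / z"] by (simp add: norm_divide dist_norm norm_minus_commute)
  qed
  have "w \<noteq> 0"
    using assms by auto
  then have "u / z = (w / z) * (u / w)"
    by simp
  then have "Ln (u / z) = Ln (w / z) + Ln (u / w)"
    using Ln_mult_Re_pos[OF Re[OF assms(1,4)] Re[OF assms(2,5)]] by simp
  then show ?thesis
    by (simp add: angle_def)
qed

definition torus_angle :: "nat \<Rightarrow> (idx \<Rightarrow> complex) \<Rightarrow> (idx \<Rightarrow> complex) \<Rightarrow> real" where
  "torus_angle j x y = angle (x (Base j)) (y (Base j))"

lemma torus_angle_add:
  assumes "x \<in> tower m" "y \<in> tower m" "z \<in> tower m" "j < m"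
    and "close (Base ` {..<m}) 1 x y" "close (Base ` {..<m}) 1 y z"
  shows "torus_angle j x z = torus_angle j x y + torus_angle j y z"
  unfolding torus_angle_def using assms tower_Base[where m = m and j = j]
  by (intro angle_add) (auto simp: close_def)

text \<open>The fundamental cocycle of the torus is a coboundary at the scale \<open>(A, e)\<close>.
  The explicit scale replaces germs of cochains along the diagonal; the first clause says that
  \<open>b\<close> has degree \<open>m - 1\<close>.\<close>

definition cobounds :: "nat \<Rightarrow> idx set \<Rightarrow> real \<Rightarrow> ((nat \<Rightarrow> idx \<Rightarrow> complex) \<Rightarrow> real) \<Rightarrow> bool" where
  "cobounds m A e b \<longleftrightarrow>
     (\<forall>x y. (\<forall>k<m. x k = y k) \<longrightarrow> b x = b y) \<and>
     (\<forall>x. (\<forall>k\<le>m. x k \<in> tower m) \<longrightarrow> (\<forall>k\<le>m. \<forall>l\<le>m. close A e (x k) (x l)) \<longrightarrow>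
       cob m b x = alt_cup m torus_angle x)"

text \<open>If the dimension is less than \<open>m\<close>, points can be labelled by members of a fine cover such that
  no \<open>m + 1\<close> points close to each other have distinct labels. Moving the points to their labels changes
  the cocycle by a coboundary and makes it vanish.\<close>

lemma cobounds_if_dim_less:
  assumes "covering_dim_le (top_of_set (tower m)) (int m - 1)"
  obtains A e b where "finite A" "e > 0" "cobounds m A e b"
proof -
  let ?X = "tower m" and ?T = "Base ` {..<m}"
  \<comment> \<open>This size makes angles additive inside each member, also after
    refinement.\<close>
  obtain \<U> where U: "fine_cover m ?T 1 \<U>"
    using fine_cover_exists[of ?T 1 m] by auto
  then have "finite_open_cover (top_of_set ?X) \<U>"
    by (simp add: fine_cover_def)
  then obtain \<V> where V: "finite_open_cover (top_of_set ?X) \<V>" "\<forall>V\<in>\<V>. \<exists>U\<in>\<U>. V \<subseteq> U"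
      and card: "\<forall>x\<in>topspace (top_of_set ?X). int (card {V\<in>\<V>. x \<in> V}) \<le> int m - 1 + 1"
    using assms unfolding covering_dim_le_def by meson
  have order: "card {V\<in>\<V>. x \<in> V} \<le> m" if "x \<in> ?X" for x
    using card that by simp
  have small: "close ?T 1 x y" if xy: "V \<in> \<V>" "x \<in> V" "y \<in> V" for V x y
  proof -
    obtain U where "U \<in> \<U>" "V \<subseteq> U"
      using V(2) xy(1) by blast
    then show ?thesis
      using U xy unfolding fine_cover_def by blast
  qed
  have VX: "V \<subseteq> ?X" if "V \<in> \<V>" for V
    using V(1) that by (auto simp: finite_open_cover_def)
  obtain A e where Ae: "finite A" "e > 0"
      "\<And>x. x \<in> ?X \<Longrightarrow> \<exists>V\<in>\<V>. \<forall>y\<in>?X. close A e x y \<longrightarrow> y \<in> V"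
    using lebesgue_close[OF compact_tower V(1)] by blast
  obtain lab where lab: "\<And>x. x \<in> ?X \<Longrightarrow> lab x \<in> \<V>"
      "\<And>x y. x \<in> ?X \<Longrightarrow> y \<in> ?X \<Longrightarrow> close A e x y \<Longrightarrow> y \<in> lab x"
    using Ae(3) by metis
  have lab_self: "x \<in> lab x" if "x \<in> ?X" for x
    using lab(2)[OF that that] Ae(2) by (simp add: close_refl)
  define pt where "pt V = (SOME p. p \<in> V)" for V :: "(idx \<Rightarrow> complex) set"
  have pt: "pt (lab x) \<in> lab x" if "x \<in> ?X" for x
    using someI[of "\<lambda>p. p \<in> lab x", OF lab_self[OF that]] by (simp add: pt_def)
  \<comment> \<open>For nearby points, adding the coboundary of \<open>s j\<close> replaces their
    angle by the angle between the chosen points of their labels, which is 0 for equal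
    labels.\<close>
  define s where "s j x = torus_angle j x (pt (lab x))" for j x
  obtain b where b: "\<forall>x y. (\<forall>k<m. x k = y k) \<longrightarrow> b x = b y"
    "\<forall>x. (\<forall>j<m. additive_on x m (torus_angle j)) \<longrightarrow>
      cob m b x = alt_cup m (\<lambda>j. twist (torus_angle j, s j)) x - alt_cup m torus_angle x"
    using alt_cup_twist[of m torus_angle s] by blast
  \<comment> \<open>The sign arises because the twisted determinant vanishes, so that
    \<open>cob m b\<close> is minus the cocycle.\<close>
  have "cob m (\<lambda>x. - 1 * b x) x = alt_cup m torus_angle x"
    if X: "\<And>k. k \<le> m \<Longrightarrow> x k \<in> ?X" and cl: "\<And>k l. k \<le> m \<Longrightarrow> l \<le> m \<Longrightarrow> close (A \<union> ?T) (min e 1) (x k) (x l)"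
    for x
  proof -
    have clT: "close ?T 1 (x k) (x l)" if "k \<le> m" "l \<le> m" for k l
      using close_mono[OF cl[OF that], of ?T 1] by auto
    have add: "additive_on x m (torus_angle j)" if "j < m" for j
      unfolding additive_on_def using X clT that
      by (intro allI impI torus_angle_add[of _ m]) auto
    \<comment> \<open>All \<open>m + 1\<close> labels contain \<open>x 0\<close>, which lies in at
      most \<open>m\<close> members, so two vertices share a label.\<close>
    have "x 0 \<in> lab (x k)" if "k \<le> m" for k
      using that by (intro lab(2) X close_mono[OF cl]) auto
    then have "(\<lambda>k. lab (x k)) ` {..m} \<subseteq> {V\<in>\<V>. x 0 \<in> V}"
      using X lab(1) by auto
    moreover have "finite {V\<in>\<V>. x 0 \<in> V}"
      using V(1) by (simp add: finite_open_cover_def)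
    ultimately have "card ((\<lambda>k. lab (x k)) ` {..m}) \<le> m"
      using order[OF X[of 0]] by (meson card_mono le_trans zero_le)
    then have "\<not> inj_on (\<lambda>k. lab (x k)) {..m}"
      by (auto dest: card_image)
    then obtain p q where pq: "p < q" "q \<le> m" "lab (x p) = lab (x q)"
      unfolding inj_on_def by (metis atMost_iff linorder_neq_iff)
    have "twist (torus_angle j, s j) (x p) (x q) = 0" if j: "j < m" for j
    proof -
      let ?V = "lab (x p)"
      have xX: "x p \<in> ?X" "x q \<in> ?X"
        using X pq(1,2) by auto
      have V: "?V \<in> \<V>" "x p \<in> ?V" "x q \<in> ?V" "pt ?V \<in> ?V"
        using lab(1) lab_self[OF xX(1)] lab_self[OF xX(2)] pt xX pq(3) by auto
      have "torus_angle j (x p) (pt ?V) = torus_angle j (x p) (x q) + torus_angle j (x q) (pt ?V)"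
        using V xX VX j small by (intro torus_angle_add[of _ m]) auto
      then show ?thesis
        using pq(3) by (simp add: twist_def s_def)
    qed
    then have "alt_cup m (\<lambda>j. twist (torus_angle j, s j)) x = 0"
      using pq(1,2) add by (intro alt_cup_degenerate[of m x _ p q] additive_on_twist) auto
    then show ?thesis
      unfolding cob_cmult using b(2) add by simp
  qed
  moreover have "- 1 * b x = - 1 * b y" if "\<And>k. k < m \<Longrightarrow> x k = y k" for x y
    using b(1) that by metis
  ultimately have "cobounds m (A \<union> ?T) (min e 1) (\<lambda>x. - 1 * b x)"
    unfolding cobounds_def by blast
  then show ?thesis
    using Ae(1,2) by (intro that[of "A \<union> ?T" "min e 1"]) auto
qed

text \<open>The transfer along a root extension: the cochain is averaged over the branches of the root that
  are close to each other. Where the right-hand side is small all branches are close to each other,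
  so they may be identified, and there the average is the original cochain.\<close>

lemma cobounds_transfer:
  assumes m: "m \<ge> 1" and A: "finite A" "Root n \<iota> \<phi> \<in> A" "\<And>k. k \<in> A \<Longrightarrow> (Root n \<iota> \<phi>, k) \<notin> sub"
    and e: "e > 0" and b: "cobounds m A e b"
  obtains B e' b' where "finite B" "B \<subseteq> range \<iota>" "e' > 0" "cobounds m (A - {Root n \<iota> \<phi>} \<union> B) e' b'"
proof -
  let ?i = "Root n \<iota> \<phi>" and ?X = "tower m"
  define f where "f = rhs \<iota> \<phi>"
  obtain d where d: "d > 0" "d \<le> 1 / 2" "\<And>w. norm (w - 1) < d \<Longrightarrow> norm (rt n w - 1) < e / 2"
    using rt_near_1[of "e / 2" n] e by auto
  \<comment> \<open>The factor 4 leaves room for a threshold \<rho> for the cochain, a threshold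
    \<open>2 * \<rho>\<close> for the lifts and a spread of \<rho> / 2 within a simplex; values
    below \<open>4 * \<rho>\<close> have roots below \<open>e / 2\<close>.\<close>
  define \<rho> where "\<rho> = (e / 2) ^ Suc n / 4"
  have \<rho>: "\<rho> > 0" "4 * \<rho> = (e / 2) ^ Suc n"
    using e by (simp_all add: \<rho>_def)
  obtain B eB where B: "finite B" "B \<subseteq> range \<iota>" "eB > 0"
    "\<And>x y. x \<in> ?X \<Longrightarrow> y \<in> ?X \<Longrightarrow> close B eB x y \<Longrightarrow> dist (f x) (f y) < d * \<rho>"
    using uniform_close_continuous[OF compact_tower continuous_on_rhs, of "range \<iota>" \<iota> \<phi> "d * \<rho>" m]
      d(1) \<rho>(1) unfolding f_def by (metis mult_pos_pos rangeI rhs_cong)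
  define lift where "lift x z = (SOME y. y \<in> ?X \<and> y ?i = z \<and> (\<forall>k. k \<noteq> ?i \<longrightarrow> (?i, k) \<notin> sub \<longrightarrow> y k = x k))"
    for x z
  have lift: "lift x z \<in> ?X \<and> lift x z ?i = z \<and> (\<forall>k. k \<noteq> ?i \<longrightarrow> (?i, k) \<notin> sub \<longrightarrow> lift x z k = x k)"
    if xz: "x \<in> ?X" "z ^ Suc n = f x" for x z
  proof -
    obtain y where "y \<in> ?X" "y ?i = z" "\<And>k. k \<noteq> ?i \<Longrightarrow> (?i, k) \<notin> sub \<Longrightarrow> y k = x k"
      using tower_lift[OF xz[unfolded f_def]] by blast
    then have "\<exists>y. y \<in> ?X \<and> y ?i = z \<and> (\<forall>k. k \<noteq> ?i \<longrightarrow> (?i, k) \<notin> sub \<longrightarrow> y k = x k)"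
      by blast
    from someI_ex[OF this] show ?thesis
      unfolding lift_def .
  qed
  \<comment> \<open>Where \<open>f\<close> is small the branches are identified: every lift is the
    point itself.\<close>
  define L where "L x z = (if norm (f x) < 2 * \<rho> then x else lift x z)" for x z
  have L: "L x z \<in> ?X" "\<And>k. k \<noteq> ?i \<Longrightarrow> (?i, k) \<notin> sub \<Longrightarrow> L x z k = x k"
    if "x \<in> ?X" "z ^ Suc n = f x" for x z
    using lift[OF that] that(1) by (auto simp: L_def)
  \<comment> \<open>The branch \<open>z\<close> over \<open>x 0\<close>, continued to the other
    vertices of the simplex.\<close>
  define Y where "Y z x k = L (x k) (z * rt n (f (x k) / f (x 0)))" for z and x :: "nat \<Rightarrow> idx \<Rightarrow> complex" and k
  define R where "R c = {z. z ^ Suc n = c}" for c :: complex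
  \<comment> \<open>If a vertex of a small simplex is below \<rho>, all are below
    \<open>2 * \<rho>\<close> and all lifts are trivial. Both formulas then give \<open>b\<close>,
    so the faces agree even if only some of them contain that vertex.\<close>
  define b' where "b' x = (if \<exists>k<m. norm (f (x k)) < \<rho> then b x
      else (\<Sum>z\<in>R (f (x 0)). b (Y z x)) / Suc n)" for x
  have local: "b x = b y" if "\<And>k. k < m \<Longrightarrow> x k = y k" for x y
    using b that unfolding cobounds_def by blast
  have bcob: "cob m b x = alt_cup m torus_angle x"
    if "\<And>k. k \<le> m \<Longrightarrow> x k \<in> ?X" "\<And>k l. k \<le> m \<Longrightarrow> l \<le> m \<Longrightarrow> close A e (x k) (x l)" for x
    using b that unfolding cobounds_def by blast
  have cardR: "card (R c) = Suc n" if "c \<noteq> 0" for c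
    unfolding R_def by (rule card_nth_roots) (use that in auto)
  have small_root: "norm z < e / 2" if "z ^ Suc n = c" "norm c < 4 * \<rho>" for z c :: complex
  proof -
    have "norm z ^ Suc n = norm c"
      using that(1) by (simp only: norm_power[symmetric])
    then have "norm z ^ Suc n < (e / 2) ^ Suc n"
      using that(2) unfolding \<rho>(2)[symmetric] by (simp only:)
    then show ?thesis
      by (rule power_less_imp_less_base) (use e in auto)
  qed
  have "b' x = b' y" if xy: "\<And>k. k < m \<Longrightarrow> x k = y k" for x y
  proof -
    have x0: "x 0 = y 0"
      using xy m by simp
    have "b x = b y"
      using xy by (rule local)
    moreover have "b (Y z x) = b (Y z y)" for z
      by (rule local) (simp add: Y_def xy x0)
    moreover have "(\<exists>k<m. norm (f (x k)) < \<rho>) \<longleftrightarrow> (\<exists>k<m. norm (f (y k)) < \<rho>)"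
      using xy by auto
    ultimately show ?thesis
      unfolding b'_def x0 by (simp only:)
  qed
  moreover have "cob m b' x = alt_cup m torus_angle x"
    if X: "\<And>k. k \<le> m \<Longrightarrow> x k \<in> ?X"
      and cl: "\<And>k l. k \<le> m \<Longrightarrow> l \<le> m \<Longrightarrow> close (A - {?i} \<union> B) (min e eB) (x k) (x l)" for x
  proof -
    have f: "dist (f (x k)) (f (x l)) < d * \<rho>" if "k \<le> m" "l \<le> m" for k l
      using that by (intro B(4) X close_mono[OF cl]) auto
    have d\<rho>: "d * \<rho> \<le> \<rho> / 2"
      using mult_right_mono[OF d(2), of \<rho>] \<rho>(1) by simp
    have f_half: "norm (f (x k)) < norm (f (x l)) + \<rho> / 2" if "k \<le> m" "l \<le> m" for k l
      using f[OF that] d\<rho> norm_triangle_sub[of "f (x k)" "f (x l)"] by (simp add: dist_norm)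
    have root: "x k ?i ^ Suc n = f (x k)" if "k \<le> m" for k
      using tower_Root[OF X[OF that]] by (simp add: f_def)
    have face: "skip q k \<le> m" if "q \<le> m" "k < m" for q k
      using that by (simp add: skip_def)
    have closeA: "close A e y y'" if "k \<le> m" "l \<le> m" "dist (y ?i) (y' ?i) < e"
      "\<And>j. j \<in> A - {?i} \<Longrightarrow> y j = x k j" "\<And>j. j \<in> A - {?i} \<Longrightarrow> y' j = x l j" for k l y y'
    proof -
      have "close (A - {?i}) e (x k) (x l)"
        using that(1,2) by (intro close_mono[OF cl]) auto
      then have "dist (y j) (y' j) < e" if "j \<in> A - {?i}" for j
        using that unfolding close_def by (simp add: \<open>\<And>j. j \<in> A - {?i} \<Longrightarrow> y j = x k j\<close> \<open>\<And>j. j \<in> A - {?i} \<Longrightarrow> y' j = x l j\<close>)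
      then show ?thesis
        using that(3) unfolding close_def by (metis Diff_iff singletonD)
    qed
    show ?thesis
    proof (cases "\<exists>k\<le>m. norm (f (x k)) < \<rho>")
      case True
      then have low: "norm (f (x k)) < 2 * \<rho>" if "k \<le> m" for k
        using f_half[OF that] \<rho>(1) by fastforce
      have "b' (x \<circ> skip q) = b (x \<circ> skip q)" if q: "q \<le> m" for q
      proof (cases "\<exists>k<m. norm (f ((x \<circ> skip q) k)) < \<rho>")
        case False
        have "b (Y z (x \<circ> skip q)) = b (x \<circ> skip q)" for z
          using low face[OF q] by (intro local) (simp add: Y_def L_def)
        moreover have "\<not> norm (f ((x \<circ> skip q) 0)) < \<rho>"
        proof -
          have "0 < m"
            using m by simp
          then show ?thesis
            using False by blast
        qed
        then have "f ((x \<circ> skip q) 0) \<noteq> 0"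
          using \<rho>(1) by (auto simp del: comp_apply)
        ultimately show ?thesis
          using False cardR by (simp add: b'_def del: comp_apply of_nat_Suc)
      qed (simp add: b'_def)
      then have "cob m b' x = cob m b x"
        by (simp add: cob_def)
      moreover have "close A e (x k) (x l)" if kl: "k \<le> m" "l \<le> m" for k l
      proof -
        have "norm (f (x k)) < 4 * \<rho>" "norm (f (x l)) < 4 * \<rho>"
          using low[OF kl(1)] low[OF kl(2)] \<rho>(1) by linarith+
        then have "norm (x k ?i) < e / 2" "norm (x l ?i) < e / 2"
          using small_root[OF root[OF kl(1)]] small_root[OF root[OF kl(2)]] by blast+
        then have "dist (x k ?i) (x l ?i) < e"
          using norm_triangle_ineq4[of "x k ?i" "x l ?i"] by (simp add: dist_norm)
        then show ?thesis
          using kl by (intro closeA) auto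
      qed
      ultimately show ?thesis
        using bcob X by simp
    next
      case False
      then have high: "norm (f (x k)) \<ge> \<rho>" if "k \<le> m" for k
        using that by force
      have f0: "f (x k) \<noteq> 0" if "k \<le> m" for k
        using high[OF that] \<rho>(1) by auto
      have ratio: "norm (f (x k) / f (x l) - 1) < d" if kl: "k \<le> m" "l \<le> m" for k l
      proof -
        have "f (x k) / f (x l) - 1 = (f (x k) - f (x l)) / f (x l)"
          using f0[OF kl(2)] by (simp add: diff_divide_distrib)
        moreover have "d * \<rho> \<le> d * norm (f (x l))"
          using high[OF kl(2)] d(1) by simp
        then have "dist (f (x k)) (f (x l)) < d * norm (f (x l))"
          using f[OF kl] by simp
        ultimately show ?thesis
          using f0[OF kl(2)] by (simp add: norm_divide dist_norm divide_simps)
      qed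
      have Re: "Re (f (x k) / f (x l)) > 0" if "k \<le> m" "l \<le> m" for k l
        using ratio[OF that] d(2) by (intro Re_pos_near_1) auto
      have Yroot: "(z * rt n (f (x k) / f (x l))) ^ Suc n = f (x k)"
        if "k \<le> m" "l \<le> m" "z ^ Suc n = f (x l)" for z k l
        unfolding power_mult_distrib that(3) using f0 that(1,2) by (subst rt_power) auto
      have faces: "b' (x \<circ> skip q) = (\<Sum>z\<in>R (f (x 0)). b (Y z x \<circ> skip q)) / Suc n" if q: "q \<le> m" for q
      proof -
        have *: "b' (x \<circ> skip q) = (\<Sum>z\<in>R (f ((x \<circ> skip q) 0)). b (Y z (x \<circ> skip q))) / Suc n"
        proof -
          have "\<not> (\<exists>k<m. norm (f ((x \<circ> skip q) k)) < \<rho>)"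
            using high face[OF q] by (force simp: not_less)
          then show ?thesis
            by (auto simp: b'_def)
        qed
        show ?thesis
        proof (cases q)
          case (Suc p)
          then have s0: "(x \<circ> skip q) 0 = x 0"
            by (simp add: skip_def)
          have "Y z (x \<circ> skip q) = Y z x \<circ> skip q" for z
            unfolding fun_eq_iff Y_def s0 by (simp add: Y_def)
          then show ?thesis
            unfolding * s0 by (simp only:)
        next
          \<comment> \<open>Omitting vertex 0 makes \<open>x 1\<close> the base vertex.
            Multiplication by \<open>?c\<close> matches the branches over \<open>x 0\<close> with
            those over \<open>x 1\<close>, and multiplicativity of \<open>rt\<close> shows that
            matching branches continue alike.\<close>
          case 0
          have q0: "(x \<circ> skip q) k = x (Suc k)" for k
            by (simp add: 0 skip_def)
          let ?c = "rt n (f (x 1) / f (x 0))"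
          have "(\<Sum>w\<in>R (f (x 1)). b (Y w (x \<circ> skip q))) = (\<Sum>z\<in>R (f (x 0)). b (Y z x \<circ> skip q))"
          proof (rule sum.reindex_bij_witness[of _ "\<lambda>z. z * ?c" "\<lambda>w. w / ?c"])
            fix z assume "z \<in> R (f (x 0))"
            then show "z * ?c \<in> R (f (x 1))"
              using Yroot[of 1 0] m by (simp add: R_def del: power_Suc)
          next
            fix w assume w: "w \<in> R (f (x 1))"
            have "?c ^ Suc n = f (x 1) / f (x 0)"
              using f0[of 0] f0[of 1] m by (intro rt_power) auto
            then show "w / ?c \<in> R (f (x 0))"
              using w f0[of 0] f0[of 1] m by (simp add: R_def power_divide del: power_Suc)
            show "b (Y (w / ?c) x \<circ> skip q) = b (Y w (x \<circ> skip q))"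
            proof (rule local)
              fix k assume k: "k < m"
              have "rt n (f (x (Suc k)) / f (x 0)) = ?c * rt n (f (x (Suc k)) / f (x 1))"
              proof -
                have "f (x (Suc k)) / f (x 0) = (f (x 1) / f (x 0)) * (f (x (Suc k)) / f (x 1))"
                  using f0[of 1] m by simp
                then show ?thesis
                  using rt_mult[OF Re Re, of 1 0 "Suc k" 1] k m by simp
              qed
              then show "(Y (w / ?c) x \<circ> skip q) k = Y w (x \<circ> skip q) k"
                using q0 by (simp add: Y_def 0 skip_def)
            qed
          qed auto
          then show ?thesis
            using * q0[of 0] by simp
        qed
      qed
      have "cob m b' x = (\<Sum>q\<le>m. (-1) ^ q * ((\<Sum>z\<in>R (f (x 0)). b (Y z x \<circ> skip q)) / Suc n))"
        unfolding cob_def by (intro sum.cong) (auto simp: faces)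
      also have "\<dots> = (\<Sum>z\<in>R (f (x 0)). cob m b (Y z x)) / Suc n"
        unfolding cob_def sum_divide_distrib sum_distrib_left times_divide_eq_right
        by (rule sum.swap)
      also have "\<dots> = (\<Sum>z\<in>R (f (x 0)). alt_cup m torus_angle x) / Suc n"
      proof -
        have "cob m b (Y z x) = alt_cup m torus_angle x" if z: "z \<in> R (f (x 0))" for z
        proof -
          have z': "z ^ Suc n = f (x 0)"
            using z by (simp add: R_def)
          have YX: "Y z x k \<in> ?X" "\<And>j. j \<noteq> ?i \<Longrightarrow> (?i, j) \<notin> sub \<Longrightarrow> Y z x k j = x k j" if "k \<le> m" for k
            using L[OF X[OF that] Yroot[OF that _ z']] by (simp_all add: Y_def)
          have "dist (Y z x k ?i) (Y z x l ?i) < e" if kl: "k \<le> m" "l \<le> m" for k l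
          \<comment> \<open>If one value is below \<open>2 * \<rho>\<close>, all are below
            \<open>4 * \<rho>\<close> and every root is small; otherwise no branches are identified
            and all lifted roots are within \<open>e / 2\<close> of \<open>z\<close>.\<close>
          proof (cases "\<exists>k\<le>m. norm (f (x k)) < 2 * \<rho>")
            case True
            then have "norm (f (x k)) < 4 * \<rho>" if "k \<le> m" for k
              using f_half[OF that] \<rho>(1) by fastforce
            moreover have "Y z x k ?i ^ Suc n = f (x k)" if "k \<le> m" for k
              using lift[OF X[OF that] Yroot[OF that _ z']] Yroot[OF that _ z'] root[OF that]
              by (simp add: Y_def L_def del: power_Suc)
            ultimately have "norm (Y z x k ?i) < e / 2" "norm (Y z x l ?i) < e / 2"
              using small_root kl by blast+
            then show ?thesis
              using norm_triangle_ineq4[of "Y z x k ?i" "Y z x l ?i"] by (simp add: dist_norm)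
          next
            case False
            have "norm (z ^ Suc n) \<le> 1"
              unfolding z' f_def by (rule norm_rhs_le)
            then have z1: "norm z \<le> 1"
              unfolding norm_power by (metis norm_ge_zero not_le one_less_power zero_less_Suc)
            have "dist (Y z x k ?i) z < e / 2" if k: "k \<le> m" for k
            proof -
              have "Y z x k ?i = z * rt n (f (x k) / f (x 0))"
                using lift[OF X[OF k] Yroot[OF k _ z']] False k by (simp add: Y_def L_def)
              then have "dist (Y z x k ?i) z = norm z * norm (rt n (f (x k) / f (x 0)) - 1)"
                by (simp add: dist_norm right_diff_distrib flip: norm_mult)
              also have "\<dots> \<le> norm (rt n (f (x k) / f (x 0)) - 1)"
                using z1 by (simp add: mult_left_le_one_le)
              also have "\<dots> < e / 2"
                using ratio[OF k, of 0] by (intro d(3)) simp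
              finally show ?thesis .
            qed
            then show ?thesis
              using kl dist_triangle_half_l by blast
          qed
          \<comment> \<open>Lifting may alter coordinates above the root, but \<open>A\<close> has
            none, and the angles see base coordinates only.\<close>
          then have "cob m b (Y z x) = alt_cup m torus_angle (Y z x)"
            using YX A(3) by (intro bcob closeA) auto
          also have "\<dots> = alt_cup m torus_angle x"
            using YX(2) by (intro alt_cup_cong) (simp add: torus_angle_def)
          finally show ?thesis .
        qed
        then show ?thesis
          by simp
      qed
      also have "\<dots> = alt_cup m torus_angle x"
        using cardR[OF f0[of 0]] by (simp del: of_nat_Suc)
      finally show ?thesis .
    qed
  qed
  ultimately have "cobounds m (A - {?i} \<union> B) (min e eB) b'"
    unfolding cobounds_def by blast
  then show ?thesis
    using that B e by (metis min_less_iff_conj)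
qed

text \<open>The grid of \<open>M\<close>-th roots of unity, lifted to the tower, contradicts
  \<open>alt_cup_not_coboundary\<close>. The lifts may be wild in the root coordinates, which
  \<open>A\<close> does not contain.\<close>

lemma not_cobounds_torus:
  assumes m: "m \<ge> 1" and A: "A \<subseteq> range Base" and e: "e > 0"
  shows "\<not> cobounds m A e b"
proof
  assume b: "cobounds m A e b"
  \<comment> \<open>\<open>M > 2\<close> keeps one grid step within the principal range of the
    angle; the other bound makes a step shorter than \<open>e\<close>.\<close>
  obtain M :: nat where "max 2 (2 * pi / e) < M"
    using reals_Archimedean2 by blast
  then have M: "M > 2" "2 * pi / e < M"
    by auto
  define \<theta> where "\<theta> = 2 * pi / M"
  have \<theta>: "\<theta> > 0" "\<theta> \<le> pi" "\<theta> < e" "M * \<theta> = 2 * pi"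
    using M e by (auto simp: \<theta>_def field_simps)
  define u where "u v j = (if j < m then cis (\<theta> * real (v j)) else 0)" for v :: "nat \<Rightarrow> nat" and j
  \<comment> \<open>The choice depends on \<open>u v\<close> only, so \<open>G\<close> is periodic
    although lifts are not unique.\<close>
  define G where "G v = (SOME y. y \<in> tower m \<and> (\<forall>j. y (Base j) = u v j))" for v
  have G: "G v \<in> tower m \<and> (\<forall>j. G v (Base j) = u v j)" for v
  proof -
    have "norm (u v j) = (if j < m then 1 else 0)" for j
      by (simp add: u_def)
    then obtain y where "y \<in> tower m" "\<And>j. y (Base j) = u v j"
      by (rule tower_over_torus[of "u v" m]) blast
    then have "\<exists>y. y \<in> tower m \<and> (\<forall>j. y (Base j) = u v j)"
      by blast
    from someI_ex[OF this] show ?thesis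
      unfolding G_def .
  qed
  have cis_mod: "cis (\<theta> * real t) = cis (\<theta> * real (t mod M))" for t
  proof -
    have "\<theta> * real t = \<theta> * real (t div M * M + t mod M)"
      by simp
    also have "\<dots> = \<theta> * real (t mod M) + 2 * pi * real (t div M)"
      using \<theta>(4) unfolding of_nat_add of_nat_mult by (simp add: algebra_simps)
    finally show ?thesis
      by (metis cis_mult cis_multiple_2pi Ints_of_nat mult.right_neutral)
  qed
  show False
  proof (rule alt_cup_not_coboundary[where G = G and a = torus_angle and b = b and h = \<theta> and M = M, OF m])
    show "G v = G w" if "\<And>j. j < m \<Longrightarrow> v j mod M = w j mod M" for v w
    proof -
      have "u v = u w"
        using that cis_mod unfolding u_def by (intro ext) metis
      then show ?thesis
        by (simp add: G_def)
    qed
    show "torus_angle j (G v) (G (v(c := v c + 1))) = (if j = c then \<theta> else 0)" if "j < m" "c < m" for v j c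
    proof -
      have "cis (\<theta> * real (v c + 1)) = cis (\<theta> * real (v c)) * cis \<theta>"
        by (simp add: cis_mult algebra_simps)
      then show ?thesis
        using G that \<theta> angle_mult_cis[of "cis (\<theta> * real (v j))" \<theta>] angle_mult_cis[of "cis (\<theta> * real (v j))" 0]
        by (auto simp: torus_angle_def u_def)
    qed
    show "b x = b y" if "\<And>k. k < m \<Longrightarrow> x k = y k" for x y
      using b that unfolding cobounds_def by blast
    show "cob m b (\<lambda>k. G (path v p k)) = alt_cup m torus_angle (\<lambda>k. G (path v p k))" for v p
    proof -
      have "close A e (G (path v p k)) (G (path v p l))" for k l
        unfolding close_def
      proof
        fix i assume "i \<in> A"
        then obtain j where j: "i = Base j"
          using A by auto
        have "norm (cis (\<theta> * real (path v p k j)) - cis (\<theta> * real (path v p l j))) \<le>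
            \<bar>\<theta> * real (path v p k j) - \<theta> * real (path v p l j)\<bar>"
          by (rule norm_cis_diff_le)
        also have "\<dots> \<le> \<theta>"
          using \<theta>(1) by (auto simp: path_def algebra_simps)
        finally show "dist (G (path v p k) i) (G (path v p l) i) < e"
          using G \<theta>(3) e by (auto simp: j u_def dist_norm)
      qed
      moreover have "\<forall>x. (\<forall>k\<le>m. x k \<in> tower m) \<longrightarrow> (\<forall>k\<le>m. \<forall>l\<le>m. close A e (x k) (x l)) \<longrightarrow>
          cob m b x = alt_cup m torus_angle x"
        using b unfolding cobounds_def by (rule conjunct2)
      ultimately show ?thesis
        using G by simp
    qed
  qed (use M \<theta> in auto)
qed

lemma not_cobounds:
  assumes "m \<ge> 1" "finite A" "e > 0"
  shows "\<not> cobounds m A e b"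
  using assms(2,3)
proof (induction A arbitrary: e b rule: finite_sub_induct)
  case (Base A)
  then show ?case
    using not_cobounds_torus[OF assms(1)] by blast
next
  case (Root A n \<iota> \<phi>)
  show ?case
  proof
    assume "cobounds m A e b"
    then show False
      using cobounds_transfer[of m A n \<iota> \<phi> e b] assms(1) Root by metis
  qed
qed

lemma not_covering_dim_le_tower:
  assumes "m \<ge> 1"
  shows "\<not> covering_dim_le (top_of_set (tower m)) (int m - 1)"
  using cobounds_if_dim_less not_cobounds[OF assms] by metis

section \<open>Transport to the large carrier\<close>

definition extend_by_0 :: "('a \<Rightarrow> 'c) \<Rightarrow> ('b \<Rightarrow> real) \<Rightarrow> ('a \<Rightarrow> 'b) \<Rightarrow> 'c \<Rightarrow> real" where
  "extend_by_0 d c g r = (if r \<in> range d then c (g (inv_into UNIV d r)) else 0)"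

lemma inj_extend_by_0:
  assumes "inj d" "inj c"
  shows "inj (extend_by_0 d c)"
proof (rule injI)
  fix g h assume eq: "extend_by_0 d c g = extend_by_0 d c h"
  have "g a = h a" for a
  proof -
    have "extend_by_0 d c g (d a) = extend_by_0 d c h (d a)"
      by (simp add: eq)
    then show ?thesis
      using assms by (simp add: extend_by_0_def inj_eq)
  qed
  then show "g = h" ..
qed

text \<open>A Dedekind cut, coded by the enumeration of the rationals.\<close>

definition rational_cut :: "real \<Rightarrow> nat set" where
  "rational_cut r = {n. of_rat (from_nat n) < r}"

lemma inj_rational_cut: "inj rational_cut"
proof (rule linorder_inj_onI')
  fix r s :: real assume "r < s"
  then obtain q where "r < of_rat q" "of_rat q < s"
    using of_rat_dense by blast
  then have "to_nat q \<in> rational_cut s" "to_nat q \<notin> rational_cut r"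
    by (simp_all add: rational_cut_def)
  then show "rational_cut r \<noteq> rational_cut s"
    by blast
qed

lemma exists_inj_real_nat_sets: "\<exists>f :: nat set \<Rightarrow> real. inj f"
  using nat_sets_eqpoll_reals unfolding eqpoll_def by (meson bij_betw_imp_inj_on)

lemma exists_inj_real_countable_sets:
  obtains f :: "'a::countable set \<Rightarrow> real" where "inj f"
proof -
  obtain f :: "nat set \<Rightarrow> real" where "inj f"
    using exists_inj_real_nat_sets by blast
  moreover have "inj (image (to_nat :: 'a \<Rightarrow> nat))"
    by (simp add: inj_image_eq_iff inj_def)
  ultimately have "inj (f \<circ> image (to_nat :: 'a \<Rightarrow> nat))"
    by (rule inj_compose)
  then show ?thesis
    by (rule that)
qed

lemma exists_inj_real_complex: "\<exists>c :: complex \<Rightarrow> real. inj c"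
proof -
  obtain f :: "(bool \<times> nat) set \<Rightarrow> real" where f: "inj f"
    by (rule exists_inj_real_countable_sets)
  define g where "g z = Pair True ` rational_cut (Re z) \<union> Pair False ` rational_cut (Im z)" for z
  have "inj g"
  proof (rule injI)
    fix z w assume "g z = g w"
    then have "rational_cut (Re z) = rational_cut (Re w)" "rational_cut (Im z) = rational_cut (Im w)"
      unfolding g_def by blast+
    then show "z = w"
      using inj_rational_cut by (simp add: inj_eq complex_eq_iff)
  qed
  then show ?thesis
    using inj_compose[OF f] by blast
qed

text \<open>The list, the number and the cuts of the sequence are recorded in one subset of a
  countable type.\<close>

lemma exists_inj_real_index: "\<exists>d :: nat list \<times> nat \<times> (nat \<Rightarrow> complex) \<Rightarrow> real. inj d"
proof -
  obtain f :: "(nat list \<times> nat + nat \<times> bool \<times> nat) set \<Rightarrow> real" where f: "inj f"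
    by (rule exists_inj_real_countable_sets)
  define g where "g t = (case t of (p, k, s) \<Rightarrow> insert (Inl (p, k))
    {Inr (t, c, n) | t c n. n \<in> rational_cut (if c then Re (s t) else Im (s t))})"
    for t :: "nat list \<times> nat \<times> (nat \<Rightarrow> complex)"
  have "inj g"
  proof (rule injI)
    fix v w :: "nat list \<times> nat \<times> (nat \<Rightarrow> complex)"
    obtain p k s p' k' s' where vw: "v = (p, k, s)" "w = (p', k', s')"
      by (cases v, cases w) auto
    assume "g v = g w"
    then have eq: "\<And>z. z \<in> g v \<longleftrightarrow> z \<in> g w"
      by simp
    have "p = p'" "k = k'"
      using eq[of "Inl (p, k)"] by (simp_all add: g_def vw)
    moreover have "s t = s' t" for t
    proof -
      have "rational_cut (if c then Re (s t) else Im (s t)) = rational_cut (if c then Re (s' t) else Im (s' t))" for c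
        using eq[of "Inr (t, c, n)" for n] by (auto simp: g_def vw)
      then have "(if c then Re (s t) else Im (s t)) = (if c then Re (s' t) else Im (s' t))" for c
        by (rule injD[OF inj_rational_cut])
      from this[of True] this[of False] show ?thesis
        by (simp add: complex_eq_iff)
    qed
    ultimately show "v = w"
      by (auto simp: vw)
  qed
  then show ?thesis
    using inj_compose[OF f] by blast
qed

text \<open>An index is a well-founded tree, and is determined by the labels found along finite paths.\<close>

primrec label :: "idx \<Rightarrow> nat list \<Rightarrow> nat + nat \<times> ((nat \<Rightarrow> complex) \<Rightarrow> complex)" where
  "label (Base j) = (\<lambda>p. Inl j)"
| "label (Root n \<iota> \<phi>) = (\<lambda>p. case p of [] \<Rightarrow> Inr (n, \<phi>) | t # q \<Rightarrow> label (\<iota> t) q)"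

lemma label_inject: "label i = label k \<Longrightarrow> i = k"
proof (induction i arbitrary: k)
  case (Base j)
  have "label (Base j) [] = label k []"
    by (simp only: Base)
  then show ?case
    by (cases k) simp_all
next
  case (Root n \<iota> \<phi>)
  have root: "label (Root n \<iota> \<phi>) [] = label k []"
    by (simp only: Root(2))
  then obtain n' \<iota>' \<phi>' where k: "k = Root n' \<iota>' \<phi>'"
    by (cases k) simp_all
  have "\<iota> t = \<iota>' t" for t
  proof (rule Root(1))
    show "label (\<iota> t) = label (\<iota>' t)"
    proof
      fix q
      show "label (\<iota> t) q = label (\<iota>' t) q"
        using fun_cong[OF Root(2), where x = "t # q"] by (simp add: k)
    qed
  qed auto
  then show ?case
    using root by (auto simp: k)
qed

text \<open>\<open>k = 0\<close> reveals the constructor, \<open>k = 1\<close> the number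
  \<open>j\<close> or \<open>n\<close>, and larger \<open>k\<close> the function
  \<open>\<phi>\<close>. All values are complex so that \<open>extend_by_0\<close> applies.\<close>

definition label_fun :: "nat + nat \<times> ((nat \<Rightarrow> complex) \<Rightarrow> complex) \<Rightarrow> nat \<Rightarrow> (nat \<Rightarrow> complex) \<Rightarrow> complex" where
  "label_fun l k s = (case l of
     Inl j \<Rightarrow> if k = 0 then 0 else of_nat j
   | Inr (n, \<phi>) \<Rightarrow> if k = 0 then 1 else if k = 1 then of_nat n else \<phi> s)"

lemma label_fun_inject:
  assumes "label_fun l = label_fun l'"
  shows "l = l'"
proof -
  have eq: "label_fun l k s = label_fun l' k s" for k s
    using assms by simp
  show ?thesis
    using eq[of 0] eq[of 1] eq[of 2]
    by (cases l; cases l') (auto simp: label_fun_def fun_eq_iff)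
qed

text \<open>Labels turn an index into a complex function on a set of size at most the
  continuum.\<close>

lemma exists_inj_idx: "\<exists>f :: idx \<Rightarrow> real \<Rightarrow> real. inj f"
proof -
  obtain d :: "nat list \<times> nat \<times> (nat \<Rightarrow> complex) \<Rightarrow> real" where d: "inj d"
    using exists_inj_real_index by blast
  obtain c :: "complex \<Rightarrow> real" where c: "inj c"
    using exists_inj_real_complex by blast
  define g where "g i = (\<lambda>(p, k, s). label_fun (label i p) k s)" for i
  have "inj g"
  proof (rule injI)
    fix i k assume eq: "g i = g k"
    have "label_fun (label i p) q s = label_fun (label k p) q s" for p q s
      using fun_cong[OF eq, of "(p, q, s)"] by (simp add: g_def)
    then have "label i p = label k p" for p
      by (intro label_fun_inject ext)
    then show "i = k"
      by (intro label_inject ext)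
  qed
  then show ?thesis
    using inj_compose[OF inj_extend_by_0[OF d c]] by blast
qed

lemma exists_inj_large_carrier: "\<exists>F :: (idx \<Rightarrow> complex) \<Rightarrow> large_carrier. inj F"
  using exists_inj_idx exists_inj_real_complex inj_extend_by_0 by blast

section \<open>Homeomorphic copies and invariance of the properties\<close>

definition copy_topology :: "('a \<Rightarrow> 'b) \<Rightarrow> 'a topology \<Rightarrow> 'b topology" where
  "copy_topology F X = pullback_topology (F ` topspace X) (inv_into UNIV F) X"

lemma openin_copy_topology:
  assumes "inj F"
  shows "openin (copy_topology F X) S \<longleftrightarrow> (\<exists>U. openin X U \<and> S = F ` U)"
proof -
  have "inv_into UNIV F -` U \<inter> F ` topspace X = F ` U" if "openin X U" for U
    using openin_subset[OF that] assms by (auto simp: inv_f_f)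
  then show ?thesis
    unfolding copy_topology_def openin_pullback_topology by metis
qed

lemma topspace_copy_topology:
  assumes "inj F"
  shows "topspace (copy_topology F X) = F ` topspace X"
  using assms unfolding copy_topology_def by (auto simp: topspace_pullback_topology)

lemma homeomorphic_map_copy_topology:
  assumes "inj F"
  shows "homeomorphic_map X (copy_topology F X) F"
proof -
  have *: "{x \<in> topspace X. F x \<in> F ` U} = U" if "openin X U" for U
    using openin_subset[OF that] assms by (auto simp: inj_image_mem_iff)
  have "open_map X (copy_topology F X) F"
    unfolding open_map_def openin_copy_topology[OF assms] by blast
  moreover have "continuous_map X (copy_topology F X) F"
    unfolding continuous_map_def topspace_copy_topology[OF assms] openin_copy_topology[OF assms]
    using * by auto
  moreover have "inj_on F (topspace X)"
    using assms by (rule inj_on_subset) simp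
  ultimately show ?thesis
    by (simp add: bijective_open_imp_homeomorphic_map topspace_copy_topology[OF assms])
qed

lemma finite_open_cover_image:
  assumes F: "homeomorphic_map X Y F" and U: "finite_open_cover X \<U>"
  shows "finite_open_cover Y ((`) F ` \<U>)"
proof -
  have "openin Y (F ` U)" if "U \<in> \<U>" for U
    using F U that homeomorphic_imp_open_map by (fastforce simp: finite_open_cover_def open_map_def)
  moreover have "\<Union>((`) F ` \<U>) = F ` topspace X"
    using U unfolding finite_open_cover_def image_Union[symmetric] by simp
  ultimately show ?thesis
    using U homeomorphic_imp_surjective_map[OF F] by (simp add: finite_open_cover_def)
qed

lemma covering_dim_le_homeomorphic:
  assumes FG: "homeomorphic_maps X Y F G" and dim: "covering_dim_le X n"
  shows "covering_dim_le Y n"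
  unfolding covering_dim_le_def
proof (intro allI impI)
  fix \<U> assume U: "finite_open_cover Y \<U>"
  have F: "homeomorphic_map X Y F" and G: "homeomorphic_map Y X G"
    using FG homeomorphic_maps_map by blast+
  have GF: "\<And>x. x \<in> topspace X \<Longrightarrow> G (F x) = x" and FG': "\<And>y. y \<in> topspace Y \<Longrightarrow> F (G y) = y"
    using FG by (auto simp: homeomorphic_maps_def)
  obtain \<V> where V: "finite_open_cover X \<V>" "\<forall>V\<in>\<V>. \<exists>U\<in>(`) G ` \<U>. V \<subseteq> U"
      "\<forall>x\<in>topspace X. int (card {V\<in>\<V>. x \<in> V}) \<le> n + 1"
    using dim finite_open_cover_image[OF G U] unfolding covering_dim_le_def by meson
  have VX: "V \<subseteq> topspace X" if "V \<in> \<V>" for V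
    using V(1) that by (auto simp: finite_open_cover_def)
  have UY: "U \<subseteq> topspace Y" if "U \<in> \<U>" for U
    using U that by (auto simp: finite_open_cover_def)
  have "\<exists>U\<in>\<U>. W \<subseteq> U" if W: "W \<in> (`) F ` \<V>" for W
  proof -
    obtain V where "V \<in> \<V>" "W = F ` V"
      using W by blast
    then obtain U where "U \<in> \<U>" "V \<subseteq> G ` U"
      using V(2) by blast
    then have "W \<subseteq> U"
      unfolding \<open>W = F ` V\<close> using UY FG' by fastforce
    then show ?thesis
      using \<open>U \<in> \<U>\<close> by blast
  qed
  moreover have "int (card {W\<in>(`) F ` \<V>. y \<in> W}) \<le> n + 1" if y: "y \<in> topspace Y" for y
  proof -
    have "{W\<in>(`) F ` \<V>. y \<in> W} \<subseteq> (`) F ` {V\<in>\<V>. G y \<in> V}"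
      using VX GF by fastforce
    moreover have "finite {V\<in>\<V>. G y \<in> V}"
      using V(1) by (simp add: finite_open_cover_def)
    ultimately have "card {W\<in>(`) F ` \<V>. y \<in> W} \<le> card {V\<in>\<V>. G y \<in> V}"
      by (rule surj_card_le[rotated])
    moreover have "G y \<in> topspace X"
      using homeomorphic_imp_surjective_map[OF G] y by blast
    ultimately show ?thesis
      using V(3) by fastforce
  qed
  ultimately show "\<exists>\<W>. finite_open_cover Y \<W> \<and> (\<forall>W\<in>\<W>. \<exists>U\<in>\<U>. W \<subseteq> U) \<and>
      (\<forall>y\<in>topspace Y. int (card {W\<in>\<W>. y \<in> W}) \<le> n + 1)"
    using finite_open_cover_image[OF F V(1)] by blast
qed

lemma bounded_cfuns_compose:
  assumes "f \<in> bounded_cfuns Y" "continuous_map X Y F"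
  shows "f \<circ> F \<in> bounded_cfuns X"
proof -
  have "F ` topspace X \<subseteq> topspace Y"
    using assms(2) by (auto simp: continuous_map_def)
  then have "bounded (f ` F ` topspace X)"
    using assms(1) unfolding bounded_cfuns_def by (blast intro: bounded_subset)
  then have "bounded ((f \<circ> F) ` topspace X)"
    by (simp only: image_comp)
  moreover have "continuous_map X euclidean (f \<circ> F)"
    using assms(1) by (intro continuous_map_compose[OF assms(2)]) (simp only: bounded_cfuns_def mem_Collect_eq)
  ultimately show ?thesis
    unfolding bounded_cfuns_def by (intro CollectI conjI)
qed

lemma root_closed_homeomorphic:
  assumes FG: "homeomorphic_maps X Y F G" and X: "root_closed n X"
  shows "root_closed n Y"
  unfolding root_closed_def
proof
  fix f assume f: "f \<in> bounded_cfuns Y"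
  have F: "continuous_map X Y F" and G: "continuous_map Y X G"
      and FG': "\<And>y. y \<in> topspace Y \<Longrightarrow> F (G y) = y"
    using FG by (auto simp: homeomorphic_maps_def)
  have im: "G ` topspace Y \<subseteq> topspace X"
    using G by (auto simp: continuous_map_def)
  have "f \<circ> F \<in> bounded_cfuns X"
    using f F by (rule bounded_cfuns_compose)
  then obtain g where g: "g \<in> bounded_cfuns X" "\<And>x. x \<in> topspace X \<Longrightarrow> f (F x) = g x ^ n"
    using X by (auto simp: root_closed_def)
  have "g \<circ> G \<in> bounded_cfuns Y"
    using g(1) G by (rule bounded_cfuns_compose)
  moreover have "f y = (g \<circ> G) y ^ n" if "y \<in> topspace Y" for y
    using g(2)[of "G y"] FG'[OF that] im that by auto
  ultimately show "\<exists>g\<in>bounded_cfuns Y. \<forall>y\<in>topspace Y. f y = g y ^ n"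
    by blast
qed

lemma covering_dim_le_mono: "covering_dim_le X k \<Longrightarrow> k \<le> n \<Longrightarrow> covering_dim_le X n"
  unfolding covering_dim_le_def by (meson add_right_mono order_trans)

lemma covering_dim_eq:
  assumes "covering_dim_le X (int m)" "\<not> covering_dim_le X (int m - 1)"
  shows "covering_dim X = ereal (real m)"
  unfolding covering_dim_def
proof (rule Inf_eqI)
  fix t assume "t \<in> {ereal (real_of_int n) | n. -1 \<le> n \<and> covering_dim_le X n}"
  then obtain n where n: "t = ereal (real_of_int n)" "covering_dim_le X n"
    by auto
  have "int m \<le> n"
    using n(2) assms(2) covering_dim_le_mono[of X n "int m - 1"] by linarith
  then show "ereal (real m) \<le> t"
    unfolding n(1) by simp
next
  fix t assume "\<And>i. i \<in> {ereal (real_of_int n) | n. -1 \<le> n \<and> covering_dim_le X n} \<Longrightarrow> t \<le> i"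
  moreover have "ereal (real m) \<in> {ereal (real_of_int n) | n. -1 \<le> n \<and> covering_dim_le X n}"
    using assms(1) by (intro CollectI exI[of _ "int m"]) auto
  ultimately show "t \<le> ereal (real m)"
    by blast
qed

theorem theorem6p2:
  fixes m :: nat
  assumes "m \<ge> 1"
  shows "\<exists>X :: large_carrier topology.
           compact_space X \<and> Hausdorff_space X \<and> covering_dim X = ereal (real m) \<and>
           (\<forall>n\<ge>1. root_closed n X)"
proof -
  obtain F :: "(idx \<Rightarrow> complex) \<Rightarrow> large_carrier" where F: "inj F"
    using exists_inj_large_carrier by blast
  let ?X = "top_of_set (tower m)"
  let ?Y = "copy_topology F ?X"
  obtain G where FG: "homeomorphic_maps ?X ?Y F G"
    using homeomorphic_map_copy_topology[OF F] homeomorphic_map_maps by blast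
  then have GF: "homeomorphic_maps ?Y ?X G F"
    using homeomorphic_maps_sym by blast
  have hom: "?X homeomorphic_space ?Y"
    using FG by (auto simp: homeomorphic_space_def)
  have "Hausdorff_space (product_topology (\<lambda>_::idx. euclidean :: complex topology) UNIV)"
    by (simp add: Hausdorff_space_product_topology)
  then have "Hausdorff_space ?X"
    unfolding euclidean_product_topology by (rule Hausdorff_space_subtopology)
  moreover have "compact_space ?X"
    using compact_tower by (simp add: compact_space_subtopology)
  ultimately have "compact_space ?X" "Hausdorff_space ?X"
    by auto
  then have "compact_space ?Y" "Hausdorff_space ?Y"
    using homeomorphic_compact_space[OF hom] homeomorphic_Hausdorff_space[OF hom] by blast+
  moreover have "covering_dim ?Y = ereal (real m)"
    using covering_dim_le_homeomorphic[OF FG covering_dim_le_tower]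
      covering_dim_le_homeomorphic[OF GF] not_covering_dim_le_tower[OF assms]
    by (intro covering_dim_eq) blast+
  moreover have "root_closed n ?Y" if "n \<ge> 1" for n
    using root_closed_homeomorphic[OF FG] root_closed_tower[OF that] by blast
  ultimately show ?thesis
    by blast
qed

end
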